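(* Let $G$ be a graph, with associated graph group $\mathcal G(G)$ and singular graph monoid $S\mathcal G(G)$. Then the desingularization map $\eta:S\mathcal G(G)\to\mathbb Z[\mathcal G(G)]$, that is, the multiplicative homomorphism with $\eta(\sigma_u^{\pm1})=\sigma_u^{\pm1}$ and $\eta(\tau_u)=\sigma_u-\sigma_u^{-1}$ for all vertices $u$ of $G$, is injective.
   Context: $G$ is a simple graph with vertex set $V$ and edge set $E$. The graph group (right-angled Artin group) of $G$ is the group $\mathcal G(G)=\langle \sigma_u\ (u\in V)\mid \sigma_u\sigma_v=\sigma_v\sigma_u\text{ for }\{u,v\}\in E\rangle$, and $\mathbb Z[\mathcal G(G)]$ is its integral group ring. The singular graph monoid $S\mathcal G(G)$ is the monoid generated by $\{\sigma_u,\sigma_u^{-1},\tau_u; u\in V\}$ with relations $\sigma_u\sigma_u^{-1}=\sigma_u^{-1}\sigma_u=1$ and $\sigma_u\tau_u=\tau_u\sigma_u$ for $u\in V$, and $\sigma_u\sigma_v=\sigma_v\sigma_u$, $\sigma_u\tau_v=\tau_v\sigma_u$, $\tau_u\tau_v=\tau_v\tau_u$ for $\{u,v\}\in E$ (for both orderings of the pair $u,v$). *)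

theory Defs
  imports "HOL-Algebra.Ring" "HOL-Library.Poly_Mapping"
begin

section \<open>Monoids and groups given by generators and relations\<close>

text \<open>
  The least congruence on the free monoid of words over the alphabet \<open>A\<close> that contains the
  relations \<open>R\<close>. Relations involving letters outside \<open>A\<close> are ignored.
\<close>

inductive_set word_cong :: "'x set \<Rightarrow> ('x list \<times> 'x list) set \<Rightarrow> ('x list \<times> 'x list) set"
  for A R where
  rel: "\<lbrakk>(l, r) \<in> R; l \<in> lists A; r \<in> lists A; u \<in> lists A; v \<in> lists A\<rbrakk>
          \<Longrightarrow> (u @ l @ v, u @ r @ v) \<in> word_cong A R"
| refl: "w \<in> lists A \<Longrightarrow> (w, w) \<in> word_cong A R"
| sym: "(w, w') \<in> word_cong A R \<Longrightarrow> (w', w) \<in> word_cong A R"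
| trans: "\<lbrakk>(w, w') \<in> word_cong A R; (w', w'') \<in> word_cong A R\<rbrakk> \<Longrightarrow> (w, w'') \<in> word_cong A R"

definition word_class :: "'x set \<Rightarrow> ('x list \<times> 'x list) set \<Rightarrow> 'x list \<Rightarrow> 'x list set" where
  "word_class A R w = word_cong A R `` {w}"

definition presented_monoid :: "'x set \<Rightarrow> ('x list \<times> 'x list) set \<Rightarrow> 'x list set monoid" where
  "presented_monoid A R =
     \<lparr>carrier = lists A // word_cong A R,
      monoid.mult = (\<lambda>C D. \<Union>x\<in>C. \<Union>y\<in>D. word_class A R (x @ y)),
      one = word_class A R []\<rparr>"

text \<open>
  A group presentation: the letter \<open>(a, True)\<close> stands for the generator \<open>a\<close>, the letter
  \<open>(a, False)\<close> for its formal inverse.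
\<close>

definition inverse_rels :: "'x set \<Rightarrow> (('x \<times> bool) list \<times> ('x \<times> bool) list) set" where
  "inverse_rels A = {([(a, b), (a, \<not> b)], []) | a b. a \<in> A}"

definition presented_group ::
    "'x set \<Rightarrow> (('x \<times> bool) list \<times> ('x \<times> bool) list) set \<Rightarrow> ('x \<times> bool) list set monoid" where
  "presented_group A R =
     presented_monoid (A \<times> UNIV) (R \<union> inverse_rels A)"

definition presented_group_gen ::
    "'x set \<Rightarrow> (('x \<times> bool) list \<times> ('x \<times> bool) list) set \<Rightarrow> 'x \<Rightarrow> ('x \<times> bool) list set" where
  "presented_group_gen A R a = word_class (A \<times> UNIV) (R \<union> inverse_rels A) [(a, True)]"

lemma word_cong_lists: "(w, w') \<in> word_cong A R \<Longrightarrow> w \<in> lists A \<and> w' \<in> lists A"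
  by (induction rule: word_cong.induct) auto

lemma equiv_word_cong: "equiv (lists A) (word_cong A R)"
proof (rule equivI)
  show "word_cong A R \<subseteq> lists A \<times> lists A"
    using word_cong_lists by fast
  show "refl_on (lists A) (word_cong A R)"
    by (rule refl_onI) (rule word_cong.refl)
  show "sym (word_cong A R)"
    by (rule symI) (rule word_cong.sym)
  show "trans (word_cong A R)"
    by (rule transI) (rule word_cong.trans)
qed

lemma word_cong_append_left:
  "(w, w') \<in> word_cong A R \<Longrightarrow> u \<in> lists A \<Longrightarrow> (u @ w, u @ w') \<in> word_cong A R"
proof (induction rule: word_cong.induct)
  case (rel l r x y)
  then have "((u @ x) @ l @ y, (u @ x) @ r @ y) \<in> word_cong A R"
    by (intro word_cong.rel) auto
  then show ?case by simp
next
  case (refl w)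
  then show ?case by (simp add: word_cong.refl)
next
  case (sym w w')
  show ?case using sym.IH[OF sym.prems] by (rule word_cong.sym)
next
  case (trans w w' w'')
  show ?case using trans.IH(1)[OF trans.prems] trans.IH(2)[OF trans.prems] by (rule word_cong.trans)
qed

lemma word_cong_append_right:
  "(w, w') \<in> word_cong A R \<Longrightarrow> u \<in> lists A \<Longrightarrow> (w @ u, w' @ u) \<in> word_cong A R"
proof (induction rule: word_cong.induct)
  case (rel l r x y)
  then have "(x @ l @ (y @ u), x @ r @ (y @ u)) \<in> word_cong A R"
    by (intro word_cong.rel) auto
  then show ?case by simp
next
  case (refl w)
  then show ?case by (simp add: word_cong.refl)
next
  case (sym w w')
  show ?case using sym.IH[OF sym.prems] by (rule word_cong.sym)
next
  case (trans w w' w'')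
  show ?case using trans.IH(1)[OF trans.prems] trans.IH(2)[OF trans.prems] by (rule word_cong.trans)
qed

lemma word_cong_append:
  assumes "(x, x') \<in> word_cong A R" "(y, y') \<in> word_cong A R"
  shows "(x @ y, x' @ y') \<in> word_cong A R"
proof (rule word_cong.trans)
  show "(x @ y, x' @ y) \<in> word_cong A R"
    using assms word_cong_lists by (intro word_cong_append_right) blast+
  show "(x' @ y, x' @ y') \<in> word_cong A R"
    using assms word_cong_lists by (intro word_cong_append_left) blast+
qed

lemma word_class_eq_iff:
  "x \<in> lists A \<Longrightarrow> y \<in> lists A \<Longrightarrow>
     word_class A R x = word_class A R y \<longleftrightarrow> (x, y) \<in> word_cong A R"
  unfolding word_class_def using eq_equiv_class_iff[OF equiv_word_cong] by metis

lemma word_class_self: "w \<in> lists A \<Longrightarrow> w \<in> word_class A R w"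
  by (simp add: word_class_def word_cong.refl)

lemma carrier_presented_monoid: "carrier (presented_monoid A R) = word_class A R ` lists A"
  by (auto simp: presented_monoid_def quotient_def word_class_def)

lemma one_presented_monoid: "\<one>\<^bsub>presented_monoid A R\<^esub> = word_class A R []"
  by (simp add: presented_monoid_def)

lemma mult_presented_monoid:
  assumes "x \<in> lists A" "y \<in> lists A"
  shows "word_class A R x \<otimes>\<^bsub>presented_monoid A R\<^esub> word_class A R y = word_class A R (x @ y)"
proof -
  have "word_class A R (x' @ y') = word_class A R (x @ y)"
    if "x' \<in> word_class A R x" "y' \<in> word_class A R y" for x' y'
  proof -
    have "(x @ y, x' @ y') \<in> word_cong A R"
      using that by (auto simp: word_class_def intro: word_cong_append)
    then show ?thesis
      using word_class_eq_iff[of "x @ y" A "x' @ y'" R] word_cong_lists[of "x @ y" "x' @ y'" A R]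
      by simp
  qed
  then have "(\<Union>x'\<in>word_class A R x. \<Union>y'\<in>word_class A R y. word_class A R (x' @ y')) =
      (\<Union>x'\<in>word_class A R x. \<Union>y'\<in>word_class A R y. word_class A R (x @ y))"
    by simp
  also have "\<dots> = word_class A R (x @ y)"
    using word_class_self[OF assms(1), of R] word_class_self[OF assms(2), of R] by auto
  finally show ?thesis
    by (simp add: presented_monoid_def)
qed

lemma monoid_presented_monoid: "Group.monoid (presented_monoid A R)"
  by (rule monoidI)
     (auto simp: carrier_presented_monoid mult_presented_monoid one_presented_monoid
       simp del: in_lists_conv_set del: in_listsD in_listsI)

definition word_prod :: "('m, 'z) monoid_scheme \<Rightarrow> ('x \<Rightarrow> 'm) \<Rightarrow> 'x list \<Rightarrow> 'm" where
  "word_prod M f w = foldr (\<lambda>a m. f a \<otimes>\<^bsub>M\<^esub> m) w \<one>\<^bsub>M\<^esub>"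

context Group.monoid
begin

lemma word_prod_Nil [simp]: "word_prod G f [] = \<one>"
  by (simp add: word_prod_def)

lemma word_prod_Cons [simp]: "word_prod G f (a # w) = f a \<otimes> word_prod G f w"
  by (simp add: word_prod_def)

lemma word_prod_closed:
  "f \<in> A \<rightarrow> carrier G \<Longrightarrow> w \<in> lists A \<Longrightarrow> word_prod G f w \<in> carrier G"
  by (induction w) auto

lemma word_prod_append:
  "f \<in> A \<rightarrow> carrier G \<Longrightarrow> v \<in> lists A \<Longrightarrow> w \<in> lists A \<Longrightarrow>
     word_prod G f (v @ w) = word_prod G f v \<otimes> word_prod G f w"
proof (induction v)
  case (Cons a v)
  then show ?case
    using word_prod_closed[of f A v] word_prod_closed[of f A w] funcset_mem[of f A _ a]
    by (simp add: m_assoc)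
qed (simp add: word_prod_closed[of f A])

lemma word_prod_cong:
  assumes f: "f \<in> A \<rightarrow> carrier G"
    and R: "\<And>l r. (l, r) \<in> R \<Longrightarrow> word_prod G f l = word_prod G f r"
    and "(w, w') \<in> word_cong A R"
  shows "word_prod G f w = word_prod G f w'"
  using assms(3)
proof (induction rule: word_cong.induct)
  case (rel l r u v)
  then show ?case
    using R[of l r] by (simp add: word_prod_append[OF f])
qed auto

text \<open>The universal property of a presentation.\<close>

lemma presented_monoid_lift:
  assumes f: "f \<in> A \<rightarrow> carrier G"
    and R: "\<And>l r. (l, r) \<in> R \<Longrightarrow> word_prod G f l = word_prod G f r"
  shows "\<exists>!h. h \<in> hom (presented_monoid A R) G \<inter> extensional (carrier (presented_monoid A R)) \<and>
           h \<one>\<^bsub>presented_monoid A R\<^esub> = \<one> \<and> (\<forall>a\<in>A. h (word_class A R [a]) = f a)"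
proof -
  let ?M = "presented_monoid A R" and ?c = "word_class A R"
  define h where
    "h = restrict (\<lambda>X. word_prod G f (SOME w. w \<in> X \<and> w \<in> lists A)) (carrier ?M)"
  have h: "h (?c w) = word_prod G f w" if "w \<in> lists A" for w
  proof -
    have "(SOME v. v \<in> ?c w \<and> v \<in> lists A) \<in> ?c w"
      using someI[of "\<lambda>v. v \<in> ?c w \<and> v \<in> lists A" w] word_class_self[OF that] that by blast
    then have "(w, SOME v. v \<in> ?c w \<and> v \<in> lists A) \<in> word_cong A R"
      by (simp add: word_class_def)
    from word_prod_cong[OF f R this] show ?thesis
      using that by (simp add: h_def carrier_presented_monoid)
  qed
  show ?thesis
  proof (rule ex1I[of _ h], intro conjI ballI IntI)
    show "h \<in> hom ?M G"
      by (auto simp: hom_def carrier_presented_monoid h word_prod_closed[OF f]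
          mult_presented_monoid word_prod_append[OF f] simp del: in_lists_conv_set del: in_listsD in_listsI)
    show "h \<in> extensional (carrier ?M)"
      by (simp add: h_def)
    show "h \<one>\<^bsub>?M\<^esub> = \<one>"
      by (simp add: one_presented_monoid h)
    show "h (?c [a]) = f a" if "a \<in> A" for a
      using that funcset_mem[OF f that] by (simp add: h)
  next
    fix k
    assume k: "k \<in> hom ?M G \<inter> extensional (carrier ?M) \<and> k \<one>\<^bsub>?M\<^esub> = \<one> \<and>
      (\<forall>a\<in>A. k (?c [a]) = f a)"
    have *: "k (?c w) = word_prod G f w" if "w \<in> lists A" for w
      using that
    proof (induction w)
      case Nil
      then show ?case using k by (simp add: one_presented_monoid)
    next
      case (Cons a w)
      then have a: "a \<in> A" and w: "w \<in> lists A" by auto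
      have "k (?c (a # w)) = k (?c [a] \<otimes>\<^bsub>?M\<^esub> ?c w)"
        using a w by (simp add: mult_presented_monoid)
      also have "\<dots> = k (?c [a]) \<otimes> k (?c w)"
        using k a w by (intro hom_mult[of k ?M G]) (auto simp: carrier_presented_monoid)
      finally show ?case using k a w Cons by simp
    qed
    show "k = h"
    proof (rule extensionalityI[of _ "carrier ?M"])
      show "k \<in> extensional (carrier ?M)" using k by blast
      show "h \<in> extensional (carrier ?M)" by (simp add: h_def)
    qed (auto simp: carrier_presented_monoid h * simp del: in_lists_conv_set del: in_listsD in_listsI)
  qed
qed

end

lemma group_presented_group: "group (presented_group A R)"
proof -
  define S where "S = R \<union> inverse_rels A"
  let ?L = "A \<times> (UNIV :: bool set)"
  define inv_word :: "('a \<times> bool) list \<Rightarrow> ('a \<times> bool) list"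
    where "inv_word w = rev (map (\<lambda>(a, b). (a, \<not> b)) w)" for w
  have lists: "inv_word w \<in> lists ?L" if "w \<in> lists ?L" for w
    using that by (auto simp: inv_word_def)
  have cong: "(inv_word w @ w, []) \<in> word_cong ?L S" if "w \<in> lists ?L" for w
    using that
  proof (induction w)
    case Nil
    then show ?case by (auto simp: inv_word_def intro: word_cong.refl)
  next
    case (Cons p w)
    obtain a b where p: "p = (a, b)" by force
    have a: "a \<in> A" and w: "w \<in> lists ?L" using Cons p by auto
    have "([(a, \<not> b), (a, \<not> \<not> b)], []) \<in> S"
      using a unfolding S_def inverse_rels_def by blast
    then have "(inv_word w @ [(a, \<not> b), (a, b)] @ w, inv_word w @ [] @ w) \<in> word_cong ?L S"
      using a w lists[OF w] by (intro word_cong.rel) auto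
    moreover have "inv_word (p # w) @ p # w = inv_word w @ [(a, \<not> b), (a, b)] @ w"
      by (simp add: inv_word_def p)
    ultimately have "(inv_word (p # w) @ p # w, inv_word w @ w) \<in> word_cong ?L S"
      by (simp only: append_Nil)
    then show ?case
      by (rule word_cong.trans) (rule Cons.IH)
  qed
  have "group (presented_monoid ?L S)"
  proof (rule Group.monoid.group_l_invI[OF monoid_presented_monoid])
    fix X assume "X \<in> carrier (presented_monoid ?L S)"
    then obtain w where w: "w \<in> lists ?L" "X = word_class ?L S w"
      by (auto simp: carrier_presented_monoid)
    show "\<exists>Y\<in>carrier (presented_monoid ?L S).
        Y \<otimes>\<^bsub>presented_monoid ?L S\<^esub> X = \<one>\<^bsub>presented_monoid ?L S\<^esub>"
    proof
      show "word_class ?L S (inv_word w) \<in> carrier (presented_monoid ?L S)"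
        using lists[OF w(1)] by (auto simp: carrier_presented_monoid)
      show "word_class ?L S (inv_word w) \<otimes>\<^bsub>presented_monoid ?L S\<^esub> X = \<one>\<^bsub>presented_monoid ?L S\<^esub>"
        using w lists[OF w(1)] cong[OF w(1)] word_class_eq_iff[of "inv_word w @ w" ?L "[]" S]
        by (simp add: mult_presented_monoid one_presented_monoid)
    qed
  qed
  then show ?thesis by (simp add: presented_group_def S_def)
qed


section \<open>The integral group ring\<close>

text \<open>
  Finitely supported functions \<open>G \<Rightarrow> \<int>\<close> with the convolution product: the \<open>\<int>\<close>-bilinear
  extension of the multiplication of \<open>G\<close> along the embedding \<open>frag_of\<close>.
\<close>

definition int_group_ring :: "('g, 'z) monoid_scheme \<Rightarrow> ('g \<Rightarrow>\<^sub>0 int) ring" where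
  "int_group_ring G =
     \<lparr>carrier = {x. Poly_Mapping.keys x \<subseteq> carrier G},
      monoid.mult = (\<lambda>x y. \<Sum>g\<in>Poly_Mapping.keys x. \<Sum>h\<in>Poly_Mapping.keys y.
        Poly_Mapping.single (g \<otimes>\<^bsub>G\<^esub> h) (Poly_Mapping.lookup x g * Poly_Mapping.lookup y h)),
      one = frag_of \<one>\<^bsub>G\<^esub>,
      zero = 0,
      add = (+)\<rparr>"

lemma frag_cmul_single: "frag_cmul c (Poly_Mapping.single g d) = Poly_Mapping.single g (c * d)"
  by (rule poly_mapping_eqI) (simp add: lookup_single when_def)

lemma mult_int_group_ring:
  "x \<otimes>\<^bsub>int_group_ring G\<^esub> y = frag_extend (\<lambda>g. frag_extend (\<lambda>h. frag_of (g \<otimes>\<^bsub>G\<^esub> h)) y) x"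
  by (simp add: int_group_ring_def frag_extend_def frag_cmul_sum frag_cmul_single)

lemma int_group_ring_simps [simp]:
  "x \<in> carrier (int_group_ring G) \<longleftrightarrow> Poly_Mapping.keys x \<subseteq> carrier G"
  "\<one>\<^bsub>int_group_ring G\<^esub> = frag_of \<one>\<^bsub>G\<^esub>"
  "\<zero>\<^bsub>int_group_ring G\<^esub> = 0"
  "x \<oplus>\<^bsub>int_group_ring G\<^esub> y = x + y"
  by (simp_all add: int_group_ring_def)

lemma frag_extend_fun_diff:
  "frag_extend (\<lambda>g. f g - f' g) x = frag_extend f x - frag_extend f' x"
proof -
  have "frag_cmul c (y - z) = frag_cmul c y - frag_cmul c z" for c and y z :: "'a \<Rightarrow>\<^sub>0 int"
    by (rule poly_mapping_eqI) (simp add: lookup_minus algebra_simps)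
  then show ?thesis by (simp add: frag_extend_def sum_subtractf)
qed

lemma frag_extend_fun_add:
  "frag_extend (\<lambda>g. f g + f' g) x = frag_extend f x + frag_extend f' x"
  by (simp add: frag_extend_def sum.distrib frag_cmul_distrib2)

lemma int_group_ring_mult_add:
  "(x + y) \<otimes>\<^bsub>int_group_ring G\<^esub> z = x \<otimes>\<^bsub>int_group_ring G\<^esub> z + y \<otimes>\<^bsub>int_group_ring G\<^esub> z"
  "z \<otimes>\<^bsub>int_group_ring G\<^esub> (x + y) = z \<otimes>\<^bsub>int_group_ring G\<^esub> x + z \<otimes>\<^bsub>int_group_ring G\<^esub> y"
  unfolding mult_int_group_ring frag_extend_add frag_extend_fun_add by simp_all

lemma int_group_ring_mult_diff:
  "(x - y) \<otimes>\<^bsub>int_group_ring G\<^esub> z = x \<otimes>\<^bsub>int_group_ring G\<^esub> z - y \<otimes>\<^bsub>int_group_ring G\<^esub> z"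
  "z \<otimes>\<^bsub>int_group_ring G\<^esub> (x - y) = z \<otimes>\<^bsub>int_group_ring G\<^esub> x - z \<otimes>\<^bsub>int_group_ring G\<^esub> y"
  unfolding mult_int_group_ring frag_extend_diff frag_extend_fun_diff by simp_all

lemma int_group_ring_mult_zero:
  "0 \<otimes>\<^bsub>int_group_ring G\<^esub> z = 0" "z \<otimes>\<^bsub>int_group_ring G\<^esub> 0 = 0"
  unfolding mult_int_group_ring by (simp, rule frag_extend_eq_0, simp)

lemma int_group_ring_mult_frag_of:
  "frag_of g \<otimes>\<^bsub>int_group_ring G\<^esub> frag_of h = frag_of (g \<otimes>\<^bsub>G\<^esub> h)"
  by (simp add: mult_int_group_ring)

lemma ring_int_group_ring:
  assumes "Group.monoid G"
  shows "ring (int_group_ring G)"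
proof -
  interpret Group.monoid G by fact
  let ?R = "int_group_ring G"
  note bil = int_group_ring_mult_diff int_group_ring_mult_zero int_group_ring_mult_frag_of
  have closed: "Poly_Mapping.keys (x \<otimes>\<^bsub>?R\<^esub> y) \<subseteq> carrier G"
    if x: "Poly_Mapping.keys x \<subseteq> carrier G" and y: "Poly_Mapping.keys y \<subseteq> carrier G" for x y
  proof -
    have "Poly_Mapping.keys (frag_extend (\<lambda>h. frag_of (g \<otimes>\<^bsub>G\<^esub> h)) y) \<subseteq> carrier G"
      if g: "g \<in> carrier G" for g
    proof (rule order_trans[OF keys_frag_extend], rule UN_least)
      fix h assume "h \<in> Poly_Mapping.keys y"
      then show "Poly_Mapping.keys (frag_of (g \<otimes>\<^bsub>G\<^esub> h)) \<subseteq> carrier G"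
        using g y by auto
    qed
    with x show ?thesis
      unfolding mult_int_group_ring
      using keys_frag_extend[of "\<lambda>g. frag_extend (\<lambda>h. frag_of (g \<otimes>\<^bsub>G\<^esub> h)) y" x] by blast
  qed
  have assoc: "x \<otimes>\<^bsub>?R\<^esub> y \<otimes>\<^bsub>?R\<^esub> z = x \<otimes>\<^bsub>?R\<^esub> (y \<otimes>\<^bsub>?R\<^esub> z)"
    if x: "Poly_Mapping.keys x \<subseteq> carrier G" and y: "Poly_Mapping.keys y \<subseteq> carrier G"
      and z: "Poly_Mapping.keys z \<subseteq> carrier G" for x y z
    using x
  proof (induction x rule: frag_induction)
    case (one g)
    show ?case using y
    proof (induction y rule: frag_induction)
      case (one h)
      show ?case using z
        by (induction z rule: frag_induction)
           (use \<open>g \<in> carrier G\<close> \<open>h \<in> carrier G\<close> in \<open>simp_all add: bil m_assoc\<close>)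
    qed (simp_all add: bil)
  qed (simp_all add: bil)
  have lone: "\<one>\<^bsub>?R\<^esub> \<otimes>\<^bsub>?R\<^esub> x = x" and rone: "x \<otimes>\<^bsub>?R\<^esub> \<one>\<^bsub>?R\<^esub> = x"
    if "Poly_Mapping.keys x \<subseteq> carrier G" for x
    using that by (induction x rule: frag_induction; simp add: bil)+
  have "Poly_Mapping.keys (x + y) \<subseteq> carrier G"
    if "Poly_Mapping.keys x \<subseteq> carrier G" "Poly_Mapping.keys y \<subseteq> carrier G"
    for x y :: "'a \<Rightarrow>\<^sub>0 int"
    using that keys_add[of x y] by blast
  moreover have "\<exists>y\<in>carrier ?R. y \<oplus>\<^bsub>?R\<^esub> x = \<zero>\<^bsub>?R\<^esub>" if "x \<in> carrier ?R" for x
    using that by (intro bexI[of _ "- x"]) auto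
  ultimately have abelian: "abelian_group ?R"
    by (intro abelian_groupI) (simp_all add: add.assoc add.commute)
  show ?thesis
  proof (rule ringI)
    show "abelian_group ?R" by (rule abelian)
    show "Group.monoid ?R"
      by (rule monoidI) (use closed assoc lone rone in auto)
  qed (simp_all add: int_group_ring_mult_add)
qed

lemma a_inv_int_group_ring:
  assumes "Group.monoid G" "Poly_Mapping.keys x \<subseteq> carrier G"
  shows "\<ominus>\<^bsub>int_group_ring G\<^esub> x = - x"
proof -
  interpret ring "int_group_ring G" using ring_int_group_ring assms(1) .
  show ?thesis
    by (rule minus_equality) (use assms(2) in auto)
qed

lemma a_minus_int_group_ring:
  assumes "Group.monoid G" "Poly_Mapping.keys y \<subseteq> carrier G"
  shows "x \<ominus>\<^bsub>int_group_ring G\<^esub> y = x - y"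
  using assms by (simp add: a_minus_def a_inv_int_group_ring)


section \<open>Graph groups and singular graph monoids\<close>

text \<open>Simple graphs, not necessarily finite; the edges are two-element sets of vertices.\<close>

definition simple_graph :: "'v set \<Rightarrow> 'v set set \<Rightarrow> bool" where
  "simple_graph V E \<longleftrightarrow> (\<forall>e\<in>E. \<exists>u\<in>V. \<exists>v\<in>V. u \<noteq> v \<and> e = {u, v})"

definition graph_group_rels ::
    "'v set set \<Rightarrow> (('v \<times> bool) list \<times> ('v \<times> bool) list) set" where
  "graph_group_rels E =
     {([(u, True), (v, True)], [(v, True), (u, True)]) | u v. {u, v} \<in> E}"

definition graph_group :: "'v set \<Rightarrow> 'v set set \<Rightarrow> ('v \<times> bool) list set monoid" where
  "graph_group V E = presented_group V (graph_group_rels E)"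

definition graph_group_gen :: "'v set \<Rightarrow> 'v set set \<Rightarrow> 'v \<Rightarrow> ('v \<times> bool) list set" where
  "graph_group_gen V E u = presented_group_gen V (graph_group_rels E) u"

datatype 'v sgen = Sig 'v | SigInv 'v | Tau 'v

definition singular_gens :: "'v set \<Rightarrow> 'v sgen set" where
  "singular_gens V = Sig ` V \<union> SigInv ` V \<union> Tau ` V"

text \<open>As \<open>{u, v} = {v, u}\<close>, the relations for an edge are imposed for both orderings of its ends.\<close>

definition singular_rels :: "'v set \<Rightarrow> 'v set set \<Rightarrow> ('v sgen list \<times> 'v sgen list) set" where
  "singular_rels V E =
     {([Sig u, SigInv u], []) | u. u \<in> V} \<union>
     {([SigInv u, Sig u], []) | u. u \<in> V} \<union>
     {([Sig u, Tau u], [Tau u, Sig u]) | u. u \<in> V} \<union>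
     {([Sig u, Sig v], [Sig v, Sig u]) | u v. {u, v} \<in> E} \<union>
     {([Sig u, Tau v], [Tau v, Sig u]) | u v. {u, v} \<in> E} \<union>
     {([Tau u, Tau v], [Tau v, Tau u]) | u v. {u, v} \<in> E}"

definition singular_monoid :: "'v set \<Rightarrow> 'v set set \<Rightarrow> 'v sgen list set monoid" where
  "singular_monoid V E = presented_monoid (singular_gens V) (singular_rels V E)"

definition singular_gen :: "'v set \<Rightarrow> 'v set set \<Rightarrow> 'v sgen \<Rightarrow> 'v sgen list set" where
  "singular_gen V E x = word_class (singular_gens V) (singular_rels V E) [x]"

text \<open>
  The desingularization map: the homomorphism of monoids into the multiplicative monoid of the
  group ring with the prescribed values on the generators. It exists and is unique by
  \<open>desingularization_ex1\<close> below; membership in \<^const>\<open>extensional\<close> only fixes the irrelevant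
  values outside the carrier.
\<close>

definition is_desingularization ::
    "'v set \<Rightarrow> 'v set set \<Rightarrow> ('v sgen list set \<Rightarrow> ('v \<times> bool) list set \<Rightarrow>\<^sub>0 int) \<Rightarrow> bool" where
  "is_desingularization V E \<eta> \<longleftrightarrow>
     (let S = singular_monoid V E; s = singular_gen V E;
          G = graph_group V E; \<sigma> = graph_group_gen V E; R = int_group_ring G
      in \<eta> \<in> hom S R \<and> \<eta> \<one>\<^bsub>S\<^esub> = \<one>\<^bsub>R\<^esub> \<and>
         (\<forall>u\<in>V. \<eta> (s (Sig u)) = frag_of (\<sigma> u) \<and>
                \<eta> (s (SigInv u)) = frag_of (inv\<^bsub>G\<^esub> \<sigma> u) \<and>
                \<eta> (s (Tau u)) = frag_of (\<sigma> u) \<ominus>\<^bsub>R\<^esub> frag_of (inv\<^bsub>G\<^esub> \<sigma> u)))"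

definition desingularization ::
    "'v set \<Rightarrow> 'v set set \<Rightarrow> 'v sgen list set \<Rightarrow> ('v \<times> bool) list set \<Rightarrow>\<^sub>0 int" where
  "desingularization V E =
     (THE \<eta>. is_desingularization V E \<eta> \<and> \<eta> \<in> extensional (carrier (singular_monoid V E)))"

lemma group_graph_group: "group (graph_group V E)"
  by (simp add: graph_group_def group_presented_group)

lemma monoid_singular_monoid: "Group.monoid (singular_monoid V E)"
  by (simp add: singular_monoid_def monoid_presented_monoid)

lemma graph_group_gen_closed: "u \<in> V \<Longrightarrow> graph_group_gen V E u \<in> carrier (graph_group V E)"
  by (simp add: graph_group_def graph_group_gen_def presented_group_def presented_group_gen_def
      carrier_presented_monoid)

lemma singular_gen_closed:
  "x \<in> singular_gens V \<Longrightarrow> singular_gen V E x \<in> carrier (singular_monoid V E)"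
  by (simp add: singular_monoid_def singular_gen_def carrier_presented_monoid)

lemma graph_group_gen_commute:
  assumes "simple_graph V E" "{u, v} \<in> E"
  shows "graph_group_gen V E u \<otimes>\<^bsub>graph_group V E\<^esub> graph_group_gen V E v =
         graph_group_gen V E v \<otimes>\<^bsub>graph_group V E\<^esub> graph_group_gen V E u"
proof -
  let ?A = "V \<times> (UNIV :: bool set)" and ?R = "graph_group_rels E \<union> inverse_rels V"
  have uv: "u \<in> V" "v \<in> V"
    using assms by (auto simp: simple_graph_def doubleton_eq_iff)
  have "([(u, True), (v, True)], [(v, True), (u, True)]) \<in> ?R"
    using assms(2) by (auto simp: graph_group_rels_def)
  then have "([] @ [(u, True), (v, True)] @ [], [] @ [(v, True), (u, True)] @ []) \<in> word_cong ?A ?R"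
    using uv by (intro word_cong.rel) auto
  then show ?thesis
    using uv by (simp add: graph_group_def graph_group_gen_def presented_group_def
        presented_group_gen_def mult_presented_monoid word_class_eq_iff)
qed

lemma desingularization_ex1:
  assumes "simple_graph V E"
  shows "\<exists>!\<eta>. is_desingularization V E \<eta> \<and> \<eta> \<in> extensional (carrier (singular_monoid V E))"
proof -
  let ?G = "graph_group V E" and ?R = "int_group_ring (graph_group V E)"
  let ?\<sigma> = "graph_group_gen V E"
  let ?A = "singular_gens V" and ?S = "singular_rels V E"
  interpret G: group ?G by (rule group_graph_group)
  interpret R: ring ?R by (rule ring_int_group_ring) (rule G.monoid_axioms)
  define f where "f x = (case x of Sig u \<Rightarrow> frag_of (?\<sigma> u) | SigInv u \<Rightarrow> frag_of (inv\<^bsub>?G\<^esub> ?\<sigma> u)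
    | Tau u \<Rightarrow> frag_of (?\<sigma> u) - frag_of (inv\<^bsub>?G\<^esub> ?\<sigma> u))" for x
  have gen: "?\<sigma> u \<in> carrier ?G" if "u \<in> V" for u
    using that by (rule graph_group_gen_closed)
  have V: "u \<in> V \<and> v \<in> V" if "{u, v} \<in> E" for u v
    using that assms by (auto simp: simple_graph_def doubleton_eq_iff)
  have f: "f \<in> ?A \<rightarrow> carrier ?R"
  proof
    fix x assume "x \<in> ?A"
    then show "f x \<in> carrier ?R"
      using keys_diff by (fastforce simp: singular_gens_def f_def gen)
  qed
  have one: "x \<otimes>\<^bsub>?R\<^esub> \<one>\<^bsub>?R\<^esub> = x" if "x \<in> carrier ?R" for x
    using that by (rule R.r_one)
  have comm_inv: "g \<otimes>\<^bsub>?G\<^esub> inv\<^bsub>?G\<^esub> h = inv\<^bsub>?G\<^esub> h \<otimes>\<^bsub>?G\<^esub> g"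
    if "g \<otimes>\<^bsub>?G\<^esub> h = h \<otimes>\<^bsub>?G\<^esub> g" "g \<in> carrier ?G" "h \<in> carrier ?G" for g h
    using that by (metis G.inv_closed G.inv_solve_left G.inv_solve_right G.m_assoc G.m_closed)
  have comm: "f (Sig u) \<otimes>\<^bsub>?R\<^esub> f (Sig v) = f (Sig v) \<otimes>\<^bsub>?R\<^esub> f (Sig u)"
    "f (Sig u) \<otimes>\<^bsub>?R\<^esub> f (Tau v) = f (Tau v) \<otimes>\<^bsub>?R\<^esub> f (Sig u)"
    "f (Tau u) \<otimes>\<^bsub>?R\<^esub> f (Tau v) = f (Tau v) \<otimes>\<^bsub>?R\<^esub> f (Tau u)"
    if e: "{u, v} \<in> E" for u v
  proof -
    have g: "?\<sigma> u \<in> carrier ?G" "?\<sigma> v \<in> carrier ?G" using V[OF e] gen by auto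
    note c = graph_group_gen_commute[OF assms e]
    note c1 = comm_inv[OF c g] and c2 = comm_inv[OF c[symmetric] g(2) g(1)]
    have c3: "inv\<^bsub>?G\<^esub> ?\<sigma> u \<otimes>\<^bsub>?G\<^esub> inv\<^bsub>?G\<^esub> ?\<sigma> v = inv\<^bsub>?G\<^esub> ?\<sigma> v \<otimes>\<^bsub>?G\<^esub> inv\<^bsub>?G\<^esub> ?\<sigma> u"
      using g c by (metis G.inv_mult_group)
    show "f (Sig u) \<otimes>\<^bsub>?R\<^esub> f (Sig v) = f (Sig v) \<otimes>\<^bsub>?R\<^esub> f (Sig u)"
      "f (Sig u) \<otimes>\<^bsub>?R\<^esub> f (Tau v) = f (Tau v) \<otimes>\<^bsub>?R\<^esub> f (Sig u)"
      "f (Tau u) \<otimes>\<^bsub>?R\<^esub> f (Tau v) = f (Tau v) \<otimes>\<^bsub>?R\<^esub> f (Tau u)"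
      by (simp_all add: f_def int_group_ring_mult_diff int_group_ring_mult_frag_of c c1 c2 c3)
  qed
  have rels: "word_prod ?R f l = word_prod ?R f r" if "(l, r) \<in> ?S" for l r
  proof -
    have fc: "f (Sig u) \<in> carrier ?R" "f (SigInv u) \<in> carrier ?R" "f (Tau u) \<in> carrier ?R"
      if "u \<in> V" for u
      using that f by (auto simp: singular_gens_def Pi_iff simp del: int_group_ring_simps)
    have i: "f (Sig u) \<otimes>\<^bsub>?R\<^esub> f (SigInv u) = \<one>\<^bsub>?R\<^esub>" "f (SigInv u) \<otimes>\<^bsub>?R\<^esub> f (Sig u) = \<one>\<^bsub>?R\<^esub>"
      "f (Sig u) \<otimes>\<^bsub>?R\<^esub> f (Tau u) = f (Tau u) \<otimes>\<^bsub>?R\<^esub> f (Sig u)" if "u \<in> V" for u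
      using gen[OF that]
      by (simp_all add: f_def int_group_ring_mult_diff int_group_ring_mult_frag_of)
    from that show ?thesis
      unfolding singular_rels_def
    proof (elim UnE CollectE exE conjE Pair_inject)
      fix u v assume "l = [Sig u, Sig v]" "r = [Sig v, Sig u]" "{u, v} \<in> E"
      then show ?thesis using comm(1)[of u v] V[of u v] by (simp add: fc one del: int_group_ring_simps)
    next
      fix u v assume "l = [Sig u, Tau v]" "r = [Tau v, Sig u]" "{u, v} \<in> E"
      then show ?thesis using comm(2)[of u v] V[of u v] by (simp add: fc one del: int_group_ring_simps)
    next
      fix u v assume "l = [Tau u, Tau v]" "r = [Tau v, Tau u]" "{u, v} \<in> E"
      then show ?thesis using comm(3)[of u v] V[of u v] by (simp add: fc one del: int_group_ring_simps)
    qed (simp_all add: fc i one del: int_group_ring_simps)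
  qed
  have eq: "(is_desingularization V E \<eta> \<and> \<eta> \<in> extensional (carrier (singular_monoid V E))) \<longleftrightarrow>
      (\<eta> \<in> hom (presented_monoid ?A ?S) ?R \<inter> extensional (carrier (presented_monoid ?A ?S)) \<and>
       \<eta> \<one>\<^bsub>presented_monoid ?A ?S\<^esub> = \<one>\<^bsub>?R\<^esub> \<and> (\<forall>a\<in>?A. \<eta> (word_class ?A ?S [a]) = f a))" for \<eta>
  proof -
    have "frag_of (?\<sigma> u) \<ominus>\<^bsub>?R\<^esub> frag_of (inv\<^bsub>?G\<^esub> ?\<sigma> u) = f (Tau u)" if "u \<in> V" for u
      using gen[OF that] by (simp add: f_def a_minus_int_group_ring)
    then show ?thesis
      unfolding is_desingularization_def Let_def singular_monoid_def singular_gen_def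
      by (auto simp: singular_gens_def ball_Un f_def simp del: int_group_ring_simps)
  qed
  show ?thesis
    unfolding eq by (rule R.presented_monoid_lift[OF f rels])
qed

lemma is_desingularization_desingularization:
  "simple_graph V E \<Longrightarrow> is_desingularization V E (desingularization V E)"
  using theI'[OF desingularization_ex1, of V E] by (simp add: desingularization_def)

end

theory Submission
  imports Defs Complex_Main
begin

text \<open>
  Let \<open>\<eta>(x) = \<eta>(y)\<close>. A group letter at the front of \<open>x\<close> is a unit and can be moved to the other side.
  If \<open>x = \<tau>\<^sub>u x'\<close>, then \<open>\<tau>\<^sub>u\<close> also divides \<open>y\<close> on the left: for otherwise a representation of the graph
  group separates \<open>\<eta>(y)\<close> from the right ideal generated by \<open>\<sigma>\<^sub>u - \<sigma>\<^sub>u\<^sup>-\<^sup>1\<close>. As \<open>\<sigma>\<^sub>u - \<sigma>\<^sub>u\<^sup>-\<^sup>1\<close> is not a left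
  zero divisor of the group ring, \<open>\<tau>\<^sub>u\<close> can be cancelled. Finally, \<open>\<eta>(y) = 1\<close> excludes all \<open>\<tau>\<^sub>u\<close> from \<open>y\<close> by
  augmentation, and \<open>\<eta>\<close> is injective on the image of the graph group.
\<close>


section \<open>Operators of singular words and the heap representation\<close>

definition letter_op ::
    "('v \<Rightarrow> ('s \<Rightarrow> rat) \<Rightarrow> 's \<Rightarrow> rat) \<Rightarrow> ('v \<Rightarrow> ('s \<Rightarrow> rat) \<Rightarrow> 's \<Rightarrow> rat) \<Rightarrow>
     'v sgen \<Rightarrow> ('s \<Rightarrow> rat) \<Rightarrow> 's \<Rightarrow> rat" where
  "letter_op T T' a F = (case a of Sig u \<Rightarrow> T u F | SigInv u \<Rightarrow> T' u F
     | Tau u \<Rightarrow> (\<lambda>s. T u F s - T' u F s))"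

lemma letter_op_simps [simp]:
  "letter_op T T' (Sig u) F = T u F"
  "letter_op T T' (SigInv u) F = T' u F"
  "letter_op T T' (Tau u) F = (\<lambda>s. T u F s - T' u F s)"
  by (simp_all add: letter_op_def)

text \<open>\<open>fold\<close> lets the first letter of a word act first, so words act from the
  right. A vector killed by the first letter is therefore killed by the whole word.\<close>

abbreviation "word_op T T' \<equiv> fold (letter_op T T')"

abbreviation letters :: "'v \<Rightarrow> 'v sgen set" where
  "letters v \<equiv> {Sig v, SigInv v, Tau v}"

text \<open>
  The values of \<open>\<sigma>\<close>, \<open>\<sigma>\<^sup>-\<^sup>1\<close> and \<open>\<tau> = \<sigma> - \<sigma>\<^sup>-\<^sup>1\<close> at \<open>\<sigma> = 1\<close> and \<open>\<sigma> = 2\<close>, the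
  two eigenvalues of the operators \<open>T v\<close> below.
\<close>

fun at1 :: "'v sgen \<Rightarrow> rat" where
  "at1 (Sig v) = 1" | "at1 (SigInv v) = 1" | "at1 (Tau v) = 0"

fun at2 :: "'v sgen \<Rightarrow> rat" where
  "at2 (Sig v) = 2" | "at2 (SigInv v) = 1/2" | "at2 (Tau v) = 3/2"

definition eval1 :: "'v sgen list \<Rightarrow> rat" where "eval1 x = prod_list (map at1 x)"
definition eval2 :: "'v sgen list \<Rightarrow> rat" where "eval2 x = prod_list (map at2 x)"

text \<open>
  A heap of pieces: the pieces \<open>i < n\<close> with labels \<open>lab i\<close> are removed from the first one on, and
  a state \<open>D\<close> is the set of pieces removed so far. No two equal labels can be made adjacent by
  commutations.
\<close>

locale heap =
  fixes adj :: "'v \<Rightarrow> 'v \<Rightarrow> bool" and lab :: "nat \<Rightarrow> 'v" and n :: nat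
  assumes adj_sym: "adj u v \<Longrightarrow> adj v u"
    and adj_irrefl: "\<not> adj v v"
    and reduced: "\<lbrakk>i < j; j < n; lab i = lab j\<rbrakk> \<Longrightarrow> \<exists>k. i < k \<and> k < j \<and> \<not> adj (lab i) (lab k)"
begin

text \<open>These are the order ideals of the heap, whose order is generated by the pairs
  \<open>i < j\<close> with noncommuting labels. By \<open>adj_irrefl\<close> equal labels count as
  noncommuting, so pieces with the same label form a chain.\<close>

definition down_closed :: "nat set \<Rightarrow> bool" where
  "down_closed D \<longleftrightarrow> D \<subseteq> {..<n} \<and> (\<forall>j\<in>D. \<forall>i<j. \<not> adj (lab i) (lab j) \<longrightarrow> i \<in> D)"

definition addable :: "'v \<Rightarrow> nat set \<Rightarrow> nat \<Rightarrow> bool" where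
  "addable v D i \<longleftrightarrow> down_closed D \<and> i < n \<and> i \<notin> D \<and> lab i = v \<and> (\<forall>j<i. \<not> adj v (lab j) \<longrightarrow> j \<in> D)"

definition removable :: "'v \<Rightarrow> nat set \<Rightarrow> nat \<Rightarrow> bool" where
  "removable v D i \<longleftrightarrow> down_closed D \<and> i \<in> D \<and> lab i = v \<and> (\<forall>k\<in>D. i < k \<longrightarrow> adj v (lab k))"

text \<open>Subtracting the set of all removable pieces avoids a choice; by
  \<open>removable_unique\<close> at most one piece is lost.\<close>

definition cut :: "'v \<Rightarrow> nat set \<Rightarrow> nat set" where
  "cut v D = D - {i. removable v D i}"

text \<open>If \<open>i < j\<close>, a blocking piece \<open>k\<close> from \<open>reduced\<close>
  would have to lie in \<open>D\<close> for \<open>j\<close> to be addable and outside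
  \<open>D\<close> for \<open>i\<close> to be removable. If \<open>j < i\<close>, the ideal
  \<open>D\<close> contains \<open>j\<close> along with \<open>i\<close>. So no state is the upper
  member of one pair and the lower member of another with the same label.\<close>

lemma not_addable_removable:
  assumes "addable v D j" "removable v D i"
  shows False
proof (cases "i < j")
  case True
  have "j < n" "lab i = v" "lab j = v" and i: "i \<in> D" "\<forall>k\<in>D. i < k \<longrightarrow> adj v (lab k)"
    and j: "\<forall>k<j. \<not> adj v (lab k) \<longrightarrow> k \<in> D"
    using assms by (simp_all add: addable_def removable_def)
  then obtain k where "i < k" "k < j" "\<not> adj v (lab k)"
    using reduced[OF True] by metis
  then show False using i j by blast
next
  case False
  have "i \<noteq> j" "lab j = lab i" "i \<in> D" "j \<notin> D" "\<forall>i\<in>D. \<forall>j<i. \<not> adj (lab j) (lab i) \<longrightarrow> j \<in> D"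
    using assms by (auto simp: addable_def removable_def down_closed_def)
  moreover have "j < i" using False calculation(1) by simp
  ultimately show False using adj_irrefl by metis
qed

lemma removable_unique: "removable v D i \<Longrightarrow> removable v D j \<Longrightarrow> i = j"
  unfolding removable_def using adj_irrefl by (metis linorder_less_linear)

lemma cut_removable: "removable v D i \<Longrightarrow> cut v D = D - {i}"
  unfolding cut_def using removable_unique by blast

lemma down_closed_cut:
  assumes "removable v D i"
  shows "down_closed (D - {i})"
  using assms by (auto simp: removable_def down_closed_def)

text \<open>The cut state falls under the first case of \<open>T v\<close>, so the two states of a
  pair form a closed 2 by 2 block.\<close>

lemma addable_cut:
  assumes "removable v D i"
  shows "addable v (D - {i}) i"
proof -
  have "j \<in> D - {i}" if "j < i" "\<not> adj v (lab j)" for j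
    using assms that adj_sym[of "lab j" v] by (auto simp: removable_def down_closed_def)
  moreover have "i < n" "lab i = v"
    using assms by (auto simp: removable_def down_closed_def)
  ultimately show ?thesis
    using down_closed_cut[OF assms] by (simp add: addable_def)
qed

text \<open>Being addable with label \<open>v\<close> only constrains pieces whose labels do not
  commute with \<open>v\<close>, and the removed piece has the commuting label
  \<open>w\<close>.\<close>

lemma addable_commute:
  assumes "adj v w" "removable w D j"
  shows "addable v (D - {j}) i \<longleftrightarrow> addable v D i"
  using assms down_closed_cut[OF assms(2)] adj_irrefl
  by (auto simp: addable_def removable_def)

lemma removable_commute:
  assumes "adj v w" "removable w D j"
  shows "removable v (D - {j}) i \<longleftrightarrow> removable v D i"
  using assms down_closed_cut[OF assms(2)] adj_irrefl
  by (auto simp: removable_def)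

text \<open>
  On each pair \<open>(D - {i}, D)\<close> of states that differ by a piece with label \<open>v\<close>, \<open>T v\<close> is triangular
  with diagonal \<open>(2, 1)\<close>; states without such a partner are fixed, with eigenvalue \<open>1\<close>.
\<close>

definition T :: "'v \<Rightarrow> (nat set \<Rightarrow> rat) \<Rightarrow> nat set \<Rightarrow> rat" where
  "T v F D = (if \<exists>i. addable v D i then 2 * F D
     else if \<exists>i. removable v D i then F D + F (cut v D) else F D)"

definition T' :: "'v \<Rightarrow> (nat set \<Rightarrow> rat) \<Rightarrow> nat set \<Rightarrow> rat" where
  "T' v F D = (if \<exists>i. addable v D i then F D / 2
     else if \<exists>i. removable v D i then F D - F (cut v D) / 2 else F D)"

lemma ex_addable_cut: "removable v D i \<Longrightarrow> \<exists>i. addable v (cut v D) i"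
  using addable_cut by (auto simp: cut_removable)

lemma T_T': "T v (T' v F) = F" "T' v (T v F) = F"
proof -
  have "(\<exists>i. addable v (cut v D) i) = True" if "\<exists>i. removable v D i" for D
    using that ex_addable_cut by blast
  then have "T v (T' v F) D = F D" "T' v (T v F) D = F D" for D
    by (cases "\<exists>i. addable v D i"; cases "\<exists>i. removable v D i"; simp only: T_def T'_def if_True if_False; simp)+
  then show "T v (T' v F) = F" "T' v (T v F) = F" by blast+
qed

lemma T_linear: "T v (\<lambda>s. a * F s + b * F' s) = (\<lambda>s. a * T v F s + b * T v F' s)"
  by (rule ext) (auto simp: T_def algebra_simps)

lemma ex_commute:
  assumes "adj v w" "removable w D j"
  shows "(\<exists>i. addable v (cut w D) i) \<longleftrightarrow> (\<exists>i. addable v D i)"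
    "(\<exists>i. removable v (cut w D) i) \<longleftrightarrow> (\<exists>i. removable v D i)"
    "removable v D i \<Longrightarrow> cut v (cut w D) = D - {i, j}"
proof -
  show "(\<exists>i. addable v (cut w D) i) \<longleftrightarrow> (\<exists>i. addable v D i)"
    "(\<exists>i. removable v (cut w D) i) \<longleftrightarrow> (\<exists>i. removable v D i)"
    using assms addable_commute removable_commute by (auto simp: cut_removable)
  assume "removable v D i"
  then have "removable v (D - {j}) i" using removable_commute[OF assms] by simp
  then show "cut v (cut w D) = D - {i, j}" using assms by (auto simp: cut_removable)
qed

text \<open>For commuting labels, cutting at one does not change which case applies at the other,
  and the two cuts in either order remove the same two pieces. What remains is a check of the
  cases.\<close>

lemma T_commute:
  assumes "adj v w"
  shows "T v (T w F) = T w (T v F)"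
proof
  fix D
  note wv = adj_sym[OF assms]
  have c: "F (cut v (cut w D)) = F (cut w (cut v D))"
    if "\<exists>i. removable v D i" "\<exists>i. removable w D i"
  proof -
    from that obtain i j where ij: "removable v D i" "removable w D j" by blast
    show ?thesis
      using ex_commute(3)[OF assms ij(2,1)] ex_commute(3)[OF wv ij] by (simp add: insert_commute)
  qed
  have v: "(\<exists>i. addable v (cut w D) i) = (\<exists>i. addable v D i)"
    "(\<exists>i. removable v (cut w D) i) = (\<exists>i. removable v D i)" if "\<exists>i. removable w D i"
    using ex_commute(1,2)[OF assms] that by blast+
  have w: "(\<exists>i. addable w (cut v D) i) = (\<exists>i. addable w D i)"
    "(\<exists>i. removable w (cut v D) i) = (\<exists>i. removable w D i)" if "\<exists>i. removable v D i"
    using ex_commute(1,2)[OF wv] that by blast+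
  show "T v (T w F) D = T w (T v F) D"
    by (cases "\<exists>i. addable v D i"; cases "\<exists>i. addable w D i";
        cases "\<exists>i. removable v D i"; cases "\<exists>i. removable w D i")
       (simp_all only: T_def v w c if_True if_False, simp_all add: algebra_simps)
qed

lemma letter_op_eq:
  assumes "a \<in> letters v"
  shows "letter_op T T' a F D = (if \<exists>i. addable v D i then at2 a * F D
    else if \<exists>i. removable v D i then at1 a * F D + (at2 a - at1 a) * F (cut v D) else at1 a * F D)"
  using assms by (auto simp: T_def T'_def simp del: not_ex)

text \<open>The instance \<open>f(T) = f(1) + (f(2) - f(1)) (T - 1)\<close> of interpolation at the eigenvalues of \<open>T v\<close>.\<close>

lemma word_op_eq:
  assumes "x \<in> lists (letters v)"
  shows "word_op T T' x F D = (if \<exists>i. addable v D i then eval2 x * F D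
    else if \<exists>i. removable v D i then eval1 x * F D + (eval2 x - eval1 x) * F (cut v D)
    else eval1 x * F D)"
  using assms
proof (induction x arbitrary: F D)
  case Nil
  then show ?case by (simp add: eval1_def eval2_def)
next
  case (Cons a x)
  have e: "eval1 (a # x) = at1 a * eval1 x" "eval2 (a # x) = at2 a * eval2 x"
    by (simp_all add: eval1_def eval2_def)
  have c: "(\<exists>i. addable v (cut v D) i) = True" if "\<exists>i. removable v D i" for D
    using that ex_addable_cut by blast
  show ?case
    unfolding fold_Cons o_apply Cons.IH letter_op_eq[OF Cons.hyps(1)] e
    by (cases "\<exists>i. addable v D i"; cases "\<exists>i. removable v D i"; simp only: c if_True if_False;
        simp add: algebra_simps)
qed

section \<open>The orbit of the start vector\<close>

definition point :: "nat set \<Rightarrow> rat" where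
  "point D = (if D = {} then 1 else 0)"

text \<open>The hypothesis says that no piece with label \<open>v\<close> is minimal in the heap.
  Hence the empty state belongs to no pair for \<open>v\<close>, and its indicator is fixed.\<close>

lemma T_point:
  assumes "\<And>i. i < n \<Longrightarrow> lab i = v \<Longrightarrow> \<exists>j<i. \<not> adj v (lab j)"
  shows "T v point = point" "T' v point = point"
proof -
  have a: "\<not> addable v {} i" for i
    using assms by (auto simp: addable_def)
  \<comment> \<open>If the cut were empty, \<open>addable_cut\<close> would make the cut piece
    addable to the empty state.\<close>
  have "cut v D \<noteq> {}" if "removable v D i" for D i
    using addable_cut[OF that] cut_removable[OF that] a by metis
  moreover have "\<not> removable v {} i" for i by (simp add: removable_def)
  ultimately have "T v point D = point D" for D
    using a by (cases "D = {}") (auto simp: T_def point_def)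
  then show 1: "T v point = point" by blast
  show "T' v point = point" using T_T'(2)[of v point] by (simp add: 1)
qed

text \<open>Each syllable advances the front by one piece: after \<open>k\<close> syllables only
  states inside \<open>{..<k}\<close> carry weight, and the weight of the state
  \<open>{..<k}\<close> itself has been multiplied at each step by the nonzero factor
  \<open>eval2 x - eval1 x\<close>.\<close>

lemma word_op_point:
  assumes L: "length L = n" "\<And>i. i < n \<Longrightarrow> lab i = fst (L ! i)"
    and x: "\<And>v x. (v, x) \<in> set L \<Longrightarrow> x \<in> lists (letters v) \<and> eval1 x \<noteq> eval2 x"
  shows "word_op T T' (concat (map snd L)) point {..<n} \<noteq> 0"
proof -
  let ?F = "\<lambda>k. word_op T T' (concat (map snd (take k L))) point"
  have "(\<forall>D. ?F k D \<noteq> 0 \<longrightarrow> D \<subseteq> {..<k}) \<and> ?F k {..<k} \<noteq> 0" if "k \<le> n" for k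
    using that
  proof (induction k)
    case 0
    then show ?case by (simp add: point_def)
  next
    case (Suc k)
    then have k: "k < n" and IH: "\<And>D. ?F k D \<noteq> 0 \<Longrightarrow> D \<subseteq> {..<k}" "?F k {..<k} \<noteq> 0" by auto
    obtain v x where vx: "L ! k = (v, x)" by force
    then have "(v, x) \<in> set L" using k L(1) nth_mem by metis
    with x have xl: "x \<in> lists (letters v)" and ev: "eval1 x \<noteq> eval2 x" by auto
    have lk: "lab k = v" using L(2)[OF k] vx by simp
    have step: "?F (Suc k) = word_op T T' x (?F k)"
      using k L(1) vx by (simp add: take_Suc_conv_app_nth)
    have supp: "D \<subseteq> {..<Suc k}" if "?F (Suc k) D \<noteq> 0" for D
    proof (rule ccontr)
      assume not: "\<not> D \<subseteq> {..<Suc k}"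
      then have D: "?F k D = 0" using IH(1)[of D] by (force simp: subset_iff)
      have "?F k (cut v D) = 0" if i: "removable v D i" for i
      proof (rule ccontr)
        assume "?F k (cut v D) \<noteq> 0"
        then have sub: "D - {i} \<subseteq> {..<k}" using IH(1) cut_removable[OF i] by metis
        \<comment> \<open>Piece \<open>k\<close> has the label \<open>v\<close> of \<open>i\<close>
          and precedes it, so the ideal \<open>D\<close> would contain \<open>k\<close>, which the
          support at stage \<open>k\<close> excludes.\<close>
        have "i > k" using sub not by (auto simp: subset_iff not_less less_Suc_eq)
        then have "k \<in> D"
          using i lk adj_irrefl[of v] by (auto simp: removable_def down_closed_def)
        then show False using sub \<open>i > k\<close> by auto
      qed
      then have "?F (Suc k) D = 0"
        unfolding step word_op_eq[OF xl] by (auto simp: D)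
      then show False using that by simp
    qed
    have rem: "removable v {..<Suc k} k"
      using k lk by (auto simp: removable_def down_closed_def)
    have cut: "cut v {..<Suc k} = {..<k}"
      unfolding cut_removable[OF rem] by auto
    \<comment> \<open>The state \<open>{..<Suc k}\<close> carries no weight yet, so only the
      contribution of its cut \<open>{..<k}\<close> survives.\<close>
    have z: "?F k {..<Suc k} = 0" using IH(1)[of "{..<Suc k}"] by auto
    have ex: "(\<exists>i. addable v {..<Suc k} i) = False" "(\<exists>i. removable v {..<Suc k} i) = True"
      using rem not_addable_removable[OF _ rem] by blast+
    have "?F (Suc k) {..<Suc k} = (eval2 x - eval1 x) * ?F k {..<k}"
      unfolding step word_op_eq[OF xl] cut ex z if_True if_False by simp
    then show ?case using supp IH(2) ev by auto
  qed
  from this[of n] show ?thesis using L(1) by simp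
qed

end


section \<open>Separating the images of words by representations\<close>

lemma list_split_two_nth:
  assumes "i < j" "j < length L"
  shows "L = take i L @ L ! i # take (j - Suc i) (drop (Suc i) L) @ L ! j # drop (Suc j) L"
proof -
  have "drop (Suc i) L = take (j - Suc i) (drop (Suc i) L) @ drop j L"
    using append_take_drop_id[of "j - Suc i" "drop (Suc i) L"] assms by simp
  also have "drop j L = L ! j # drop (Suc j) L"
    using assms by (simp add: Cons_nth_drop_Suc)
  finally show ?thesis using id_take_nth_drop[of i L] assms by simp
qed

text \<open>This is the additive extension of \<open>c\<close> to the group ring. For
  \<open>c\<close> a matrix entry of a representation it evaluates that entry on a group ring
  element.\<close>

definition frag_eval :: "('g \<Rightarrow> rat) \<Rightarrow> ('g \<Rightarrow>\<^sub>0 int) \<Rightarrow> rat" where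
  "frag_eval c z = (\<Sum>g\<in>Poly_Mapping.keys z. of_int (Poly_Mapping.lookup z g) * c g)"

lemma frag_eval_superset:
  assumes "finite K" "Poly_Mapping.keys z \<subseteq> K"
  shows "frag_eval c z = (\<Sum>g\<in>K. of_int (Poly_Mapping.lookup z g) * c g)"
  unfolding frag_eval_def using assms
  by (intro sum.mono_neutral_left) (auto simp: in_keys_iff)

lemma frag_eval_simps [simp]:
  "frag_eval c 0 = 0" "frag_eval c (frag_of g) = c g"
  "frag_eval c (x - y) = frag_eval c x - frag_eval c y"
proof -
  let ?K = "Poly_Mapping.keys x \<union> Poly_Mapping.keys y"
  have "Poly_Mapping.keys (x - y) \<subseteq> ?K" by (rule keys_diff)
  then have "frag_eval c (x - y) = (\<Sum>g\<in>?K. of_int (Poly_Mapping.lookup (x - y) g) * c g)"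
    by (intro frag_eval_superset) auto
  moreover have "frag_eval c x = (\<Sum>g\<in>?K. of_int (Poly_Mapping.lookup x g) * c g)"
    "frag_eval c y = (\<Sum>g\<in>?K. of_int (Poly_Mapping.lookup y g) * c g)"
    by (intro frag_eval_superset; auto)+
  ultimately show "frag_eval c (x - y) = frag_eval c x - frag_eval c y"
    by (simp add: lookup_minus algebra_simps sum_subtractf)
qed (simp_all add: frag_eval_def)

lemma frag_eval_fun_diff: "frag_eval (\<lambda>g. c g - c' g) z = frag_eval c z - frag_eval c' z"
  by (simp add: frag_eval_def algebra_simps sum_subtractf)

lemma frag_eval_mult_left:
  assumes "Poly_Mapping.keys z \<subseteq> K"
    and "\<And>k. k \<in> K \<Longrightarrow> c (g \<otimes>\<^bsub>G\<^esub> k) = c' k"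
  shows "frag_eval c (frag_of g \<otimes>\<^bsub>int_group_ring G\<^esub> z) = frag_eval c' z"
  using assms(1)
  by (induction z rule: frag_induction)
     (simp_all add: int_group_ring_mult_zero int_group_ring_mult_frag_of int_group_ring_mult_diff assms(2))

locale graph_monoid =
  fixes V :: "'v set" and E :: "'v set set"
  assumes simple: "simple_graph V E"
begin

abbreviation "G \<equiv> graph_group V E"
abbreviation "R \<equiv> int_group_ring G"
abbreviation "\<sigma> \<equiv> graph_group_gen V E"
abbreviation "A \<equiv> singular_gens V"
abbreviation "cls \<equiv> word_class A (singular_rels V E)"
abbreviation "gcls \<equiv> word_class (V \<times> (UNIV :: bool set)) (graph_group_rels E \<union> inverse_rels V)"
abbreviation "\<eta> \<equiv> desingularization V E"

sublocale G: group G by (rule group_graph_group)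

lemma G_def: "G = presented_monoid (V \<times> UNIV) (graph_group_rels E \<union> inverse_rels V)"
  by (simp add: graph_group_def presented_group_def)

lemma edge: "{u, v} \<in> E \<Longrightarrow> u \<in> V \<and> v \<in> V \<and> u \<noteq> v"
  using simple by (auto simp: simple_graph_def doubleton_eq_iff)

lemma \<sigma>_def: "\<sigma> u = gcls [(u, True)]"
  by (simp add: graph_group_gen_def presented_group_gen_def)

lemma \<sigma>_closed: "u \<in> V \<Longrightarrow> \<sigma> u \<in> carrier G"
  by (rule graph_group_gen_closed)

lemma gens: "x \<in> A \<longleftrightarrow> (\<exists>u\<in>V. x = Sig u \<or> x = SigInv u \<or> x = Tau u)"
  by (auto simp: singular_gens_def)

lemma \<eta>_spec: "\<eta> \<in> hom (singular_monoid V E) R" "\<eta> (cls []) = frag_of \<one>\<^bsub>G\<^esub>"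
  "u \<in> V \<Longrightarrow> \<eta> (cls [Sig u]) = frag_of (\<sigma> u)"
  "u \<in> V \<Longrightarrow> \<eta> (cls [SigInv u]) = frag_of (inv\<^bsub>G\<^esub> \<sigma> u)"
  "u \<in> V \<Longrightarrow> \<eta> (cls [Tau u]) = frag_of (\<sigma> u) - frag_of (inv\<^bsub>G\<^esub> \<sigma> u)"
  using is_desingularization_desingularization[OF simple]
  by (auto simp: is_desingularization_def Let_def singular_monoid_def one_presented_monoid
      singular_gen_def a_minus_int_group_ring G.monoid_axioms \<sigma>_closed)

lemma cls_closed: "w \<in> lists A \<Longrightarrow> cls w \<in> carrier (singular_monoid V E)"
  by (auto simp: singular_monoid_def carrier_presented_monoid simp del: in_lists_conv_set)

lemma \<eta>_closed: "w \<in> lists A \<Longrightarrow> Poly_Mapping.keys (\<eta> (cls w)) \<subseteq> carrier G"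
  using hom_in_carrier[OF \<eta>_spec(1) cls_closed] by simp

lemma \<eta>_append:
  assumes "v \<in> lists A" "w \<in> lists A"
  shows "\<eta> (cls (v @ w)) = \<eta> (cls v) \<otimes>\<^bsub>R\<^esub> \<eta> (cls w)"
  using hom_mult[OF \<eta>_spec(1) cls_closed cls_closed, OF assms] assms
  by (simp add: singular_monoid_def mult_presented_monoid)

lemma \<eta>_Cons:
  "a \<in> A \<Longrightarrow> w \<in> lists A \<Longrightarrow> \<eta> (cls (a # w)) = \<eta> (cls [a]) \<otimes>\<^bsub>R\<^esub> \<eta> (cls w)"
  using \<eta>_append[of "[a]" w] by simp

text \<open>The operators \<open>T u\<close> satisfy the relations of the graph group, so they
  extend to a representation \<open>h\<close> of it. Extending \<open>h\<close> additively to the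
  group ring recovers the action of a singular word from its image under \<eta> alone.\<close>

lemma word_op_desingularization:
  fixes T T' :: "'v \<Rightarrow> ('s \<Rightarrow> rat) \<Rightarrow> 's \<Rightarrow> rat"
  assumes lin: "\<And>u a b F F'. T u (\<lambda>s. a * F s + b * F' s) = (\<lambda>s. a * T u F s + b * T u F' s)"
    and inv: "\<And>u F. T u (T' u F) = F" "\<And>u F. T' u (T u F) = F"
    and comm: "\<And>u v F. {u, v} \<in> E \<Longrightarrow> T u (T v F) = T v (T u F)"
    and w: "w \<in> lists A" "w' \<in> lists A" "\<eta> (cls w) = \<eta> (cls w')"
  shows "word_op T T' w F = word_op T T' w' F"
proof -
  let ?lin = "\<lambda>f. \<forall>a b F F'. f (\<lambda>s. a * F s + b * F' s) = (\<lambda>s. a * f F s + b * (f F' s :: rat))"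
  \<comment> \<open>The product is reversed composition, to match the right action of
    \<open>word_op\<close>.\<close>
  define M :: "(('s \<Rightarrow> rat) \<Rightarrow> 's \<Rightarrow> rat) monoid"
    where "M = \<lparr>carrier = {f. ?lin f}, monoid.mult = (\<lambda>f g. g \<circ> f), one = id\<rparr>"
  have M: "f \<otimes>\<^bsub>M\<^esub> g = g \<circ> f" "\<one>\<^bsub>M\<^esub> = id" "f \<in> carrier M \<longleftrightarrow> ?lin f" for f g
    by (simp_all add: M_def)
  interpret M: Group.monoid M
    by (rule monoidI) (auto simp: M comp_assoc)
  \<comment> \<open>Inverses of linear maps are linear; this puts \<open>T'\<close> into the carrier
    of \<open>M\<close>.\<close>
  have lin': "T' u (\<lambda>s. a * F s + b * F' s) = (\<lambda>s. a * T' u F s + b * T' u F' s)" for u a b F F'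
    using inv(2)[of u "\<lambda>s. a * T' u F s + b * T' u F' s"] by (simp add: lin inv(1))
  define f where "f p = (if snd p then T (fst p) else T' (fst p))" for p
  have f: "f \<in> V \<times> UNIV \<rightarrow> carrier M"
    by (auto simp: f_def M lin lin')
  have rels: "word_prod M f l = word_prod M f r"
    if "(l, r) \<in> graph_group_rels E \<union> inverse_rels V" for l r
    using that by (auto simp: graph_group_rels_def inverse_rels_def f_def M inv fun_eq_iff)
      (metis comm)
  from M.presented_monoid_lift[OF f, where R = "graph_group_rels E \<union> inverse_rels V", OF rels, folded G_def] obtain h where
    h: "h \<in> hom G M" "h \<one>\<^bsub>G\<^esub> = id" and h1: "\<And>a. a \<in> V \<times> UNIV \<Longrightarrow> h (gcls [a]) = f a"
    by (fastforce simp: M)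
  have hm: "h (g \<otimes>\<^bsub>G\<^esub> k) F = h k (h g F)" if "g \<in> carrier G" "k \<in> carrier G" for g k F
    using hom_mult[OF h(1) that] by (simp add: M)
  have hl: "h g (\<lambda>s. F s - F' s) = (\<lambda>s. h g F s - h g F' s)" if "g \<in> carrier G" for g F F'
  proof -
    have "?lin (h g)" using hom_in_carrier[OF h(1) that] unfolding M .
    from this[rule_format, of 1 F "-1" F'] show ?thesis by simp
  qed
  have hs: "h (\<sigma> u) = T u" if "u \<in> V" for u
    using h1[of "(u, True)"] that by (simp add: f_def \<sigma>_def)
  have hi: "h (inv\<^bsub>G\<^esub> \<sigma> u) F = T' u F" if "u \<in> V" for u F
    using hm[of "\<sigma> u" "inv\<^bsub>G\<^esub> \<sigma> u" "T' u F"] that \<sigma>_closed by (simp add: hs h(2) inv)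
  have ml: "frag_eval (\<lambda>k. h k F s) (frag_of g \<otimes>\<^bsub>R\<^esub> z) = frag_eval (\<lambda>k. h k (h g F) s) z"
    if "g \<in> carrier G" "Poly_Mapping.keys z \<subseteq> carrier G" for g z F s
    using that by (intro frag_eval_mult_left) (auto simp: hm)
  have "word_op T T' w F s = frag_eval (\<lambda>k. h k F s) (\<eta> (cls w))" if "w \<in> lists A" for w F s
    using that
  proof (induction arbitrary: F)
    case Nil
    then show ?case by (simp add: \<eta>_spec h(2))
  next
    case (Cons a w)
    then obtain u where u: "u \<in> V" and a: "a = Sig u \<or> a = SigInv u \<or> a = Tau u"
      unfolding gens by blast
    have su: "\<sigma> u \<in> carrier G" "inv\<^bsub>G\<^esub> \<sigma> u \<in> carrier G" using \<sigma>_closed[OF u] by auto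
    have z: "Poly_Mapping.keys (\<eta> (cls w)) \<subseteq> carrier G" using Cons \<eta>_closed by blast
    \<comment> \<open>Linearity of every \<open>h k\<close> splits the operator of
      \<open>Tau u\<close> into its two summands, matching the difference in \<eta>.\<close>
    have d: "frag_eval (\<lambda>k. h k (\<lambda>s. F s - F' s) s) (\<eta> (cls w)) =
        frag_eval (\<lambda>k. h k F s) (\<eta> (cls w)) - frag_eval (\<lambda>k. h k F' s) (\<eta> (cls w))" for F F'
    proof -
      have "frag_eval (\<lambda>k. h k (\<lambda>s. F s - F' s) s) (\<eta> (cls w)) =
          frag_eval (\<lambda>k. h k F s - h k F' s) (\<eta> (cls w))"
        unfolding frag_eval_def using z by (intro sum.cong) (auto simp: hl)
      then show ?thesis by (simp add: frag_eval_fun_diff)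
    qed
    show ?case
      using a by (elim disjE) (simp_all add: \<eta>_Cons[OF _ Cons.hyps(2)] gens Cons.IH \<eta>_spec u
          ml[OF su(1) z] ml[OF su(2) z] hs hi int_group_ring_mult_diff d)
  qed
  with w show ?thesis by (intro ext) simp
qed

section \<open>Left cancellation of the image of \<open>Tau u\<close> in the group ring\<close>

lemma lookup_frag_of_mult:
  assumes "Poly_Mapping.keys z \<subseteq> carrier G" "g \<in> carrier G" "k \<in> carrier G"
  shows "Poly_Mapping.lookup (frag_of g \<otimes>\<^bsub>R\<^esub> z) (g \<otimes>\<^bsub>G\<^esub> k) = Poly_Mapping.lookup z k"
  using assms(1)
proof (induction z rule: frag_induction)
  case (one x)
  then have "g \<otimes>\<^bsub>G\<^esub> x = g \<otimes>\<^bsub>G\<^esub> k \<longleftrightarrow> x = k" using assms by simp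
  then show ?case by (auto simp: int_group_ring_mult_frag_of lookup_single when_def)
qed (simp_all add: int_group_ring_mult_zero int_group_ring_mult_diff lookup_minus)

text \<open>Both sides of every defining relation have the same total exponent. The resulting
  homomorphism to the integers grades the support of group ring elements in
  \<open>tau_cancel\<close>.\<close>

lemma exponent_sum:
  obtains e :: "('v \<times> bool) list set \<Rightarrow> int" where
    "\<And>g k. g \<in> carrier G \<Longrightarrow> k \<in> carrier G \<Longrightarrow> e (g \<otimes>\<^bsub>G\<^esub> k) = e g + e k"
    "\<And>u. u \<in> V \<Longrightarrow> e (\<sigma> u) = 1"
proof -
  define M :: "int monoid" where "M = \<lparr>carrier = UNIV, monoid.mult = (+), one = 0\<rparr>"
  have M: "a \<otimes>\<^bsub>M\<^esub> b = a + b" "\<one>\<^bsub>M\<^esub> = 0" "a \<in> carrier M" for a b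
    by (simp_all add: M_def)
  interpret M: Group.monoid M by (rule monoidI) (auto simp: M)
  define f where "f p = (if snd p then 1 else -1 :: int)" for p :: "'v \<times> bool"
  have f: "f \<in> V \<times> UNIV \<rightarrow> carrier M" by (auto simp: M)
  have rels: "word_prod M f l = word_prod M f r"
    if "(l, r) \<in> graph_group_rels E \<union> inverse_rels V" for l r
    using that by (auto simp: graph_group_rels_def inverse_rels_def f_def M)
  from M.presented_monoid_lift[OF f, where R = "graph_group_rels E \<union> inverse_rels V", OF rels, folded G_def] obtain h where
    h: "h \<in> hom G M" and h1: "\<And>a. a \<in> V \<times> UNIV \<Longrightarrow> h (gcls [a]) = f a"
    by fastforce
  show thesis
  proof (rule that[of h])
    show "h (g \<otimes>\<^bsub>G\<^esub> k) = h g + h k" if "g \<in> carrier G" "k \<in> carrier G" for g k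
      using hom_mult[OF h that] by (simp add: M)
    show "h (\<sigma> u) = 1" if "u \<in> V" for u
      using h1[of "(u, True)"] that by (simp add: f_def \<sigma>_def)
  qed
qed

text \<open>A nonzero difference \<open>d\<close> would satisfy \<sigma> d = \<sigma>^-1 d, with
  \<sigma> standing for \<open>\<sigma> u\<close>, so its support would be closed under left
  multiplication by \<sigma>^2. This raises the exponent sum by 2, which is impossible at an element
  of maximal exponent sum in the finite support.\<close>

lemma tau_cancel:
  assumes u: "u \<in> V" and z: "Poly_Mapping.keys z \<subseteq> carrier G" "Poly_Mapping.keys z' \<subseteq> carrier G"
    and eq: "(frag_of (\<sigma> u) - frag_of (inv\<^bsub>G\<^esub> \<sigma> u)) \<otimes>\<^bsub>R\<^esub> z =
      (frag_of (\<sigma> u) - frag_of (inv\<^bsub>G\<^esub> \<sigma> u)) \<otimes>\<^bsub>R\<^esub> z'"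
  shows "z = z'"
proof (rule ccontr)
  assume "z \<noteq> z'"
  obtain e where e: "\<And>g k. g \<in> carrier G \<Longrightarrow> k \<in> carrier G \<Longrightarrow> e (g \<otimes>\<^bsub>G\<^esub> k) = e g + (e k :: int)"
    "\<And>u. u \<in> V \<Longrightarrow> e (\<sigma> u) = 1" using exponent_sum by blast
  define d where "d = z - z'"
  let ?K = "Poly_Mapping.keys d"
  have K: "?K \<subseteq> carrier G" using z keys_diff[of z z'] unfolding d_def by blast
  have s: "\<sigma> u \<in> carrier G" "inv\<^bsub>G\<^esub> \<sigma> u \<in> carrier G" using \<sigma>_closed[OF u] by auto
  have d: "frag_of (\<sigma> u) \<otimes>\<^bsub>R\<^esub> d = frag_of (inv\<^bsub>G\<^esub> \<sigma> u) \<otimes>\<^bsub>R\<^esub> d"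
    using eq unfolding d_def int_group_ring_mult_diff by (simp add: algebra_simps)
  have "?K \<noteq> {}" using \<open>z \<noteq> z'\<close> by (simp add: d_def)
  then have "Max (e ` ?K) \<in> e ` ?K" by (intro Max_in) auto
  then obtain k where k: "k \<in> ?K" "Max (e ` ?K) = e k" by auto
  then have kG: "k \<in> carrier G" using K by blast
  let ?k = "\<sigma> u \<otimes>\<^bsub>G\<^esub> (\<sigma> u \<otimes>\<^bsub>G\<^esub> k)"
  \<comment> \<open>Both sides of the fact \<open>d\<close> are read off at the group element
    \<sigma> k.\<close>
  have "Poly_Mapping.lookup d ?k =
      Poly_Mapping.lookup (frag_of (inv\<^bsub>G\<^esub> \<sigma> u) \<otimes>\<^bsub>R\<^esub> d) (inv\<^bsub>G\<^esub> \<sigma> u \<otimes>\<^bsub>G\<^esub> ?k)"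
    using s kG K by (simp add: lookup_frag_of_mult)
  also have "inv\<^bsub>G\<^esub> \<sigma> u \<otimes>\<^bsub>G\<^esub> ?k = \<sigma> u \<otimes>\<^bsub>G\<^esub> k"
    using s kG by (simp add: G.m_assoc[symmetric])
  also have "Poly_Mapping.lookup (frag_of (inv\<^bsub>G\<^esub> \<sigma> u) \<otimes>\<^bsub>R\<^esub> d) (\<sigma> u \<otimes>\<^bsub>G\<^esub> k) = Poly_Mapping.lookup d k"
    unfolding d[symmetric] using s kG K by (simp add: lookup_frag_of_mult)
  finally have "?k \<in> ?K" using k(1) by (simp add: in_keys_iff)
  then have "e ?k \<le> e k" using k(2) Max_ge[of "e ` ?K" "e ?k"] by simp
  moreover have "e ?k = 2 + e k" using s kG u by (simp add: e)
  ultimately show False by simp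
qed


section \<open>Commutation and syllables\<close>


definition cong :: "'v sgen list \<Rightarrow> 'v sgen list \<Rightarrow> bool" (infix "\<approx>" 50) where
  "w \<approx> w' \<longleftrightarrow> (w, w') \<in> word_cong A (singular_rels V E)"

lemma cong_sym: "w \<approx> w' \<Longrightarrow> w' \<approx> w"
  unfolding cong_def by (rule word_cong.sym)

lemma cong_trans [trans]: "w \<approx> w' \<Longrightarrow> w' \<approx> w'' \<Longrightarrow> w \<approx> w''"
  unfolding cong_def by (rule word_cong.trans)

lemma cong_refl: "w \<in> lists A \<Longrightarrow> w \<approx> w"
  unfolding cong_def by (rule word_cong.refl)

lemma cong_lists: "w \<approx> w' \<Longrightarrow> w \<in> lists A \<and> w' \<in> lists A"
  unfolding cong_def by (rule word_cong_lists)

lemma cong_context: "x \<approx> y \<Longrightarrow> p \<in> lists A \<Longrightarrow> q \<in> lists A \<Longrightarrow> p @ x @ q \<approx> p @ y @ q"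
  unfolding cong_def by (intro word_cong_append word_cong.refl)

lemma cls_eq_iff: "w \<in> lists A \<Longrightarrow> w' \<in> lists A \<Longrightarrow> cls w = cls w' \<longleftrightarrow> w \<approx> w'"
  unfolding cong_def by (rule word_class_eq_iff)

lemma cls_eqI: "w \<approx> w' \<Longrightarrow> cls w = cls w'"
  using cls_eq_iff cong_lists by blast

lemma letters_A: "u \<in> V \<Longrightarrow> letters u \<subseteq> A"
  by (auto simp: gens)

lemma cong_rel: "(l, r) \<in> singular_rels V E \<Longrightarrow> l \<in> lists A \<Longrightarrow> r \<in> lists A \<Longrightarrow> l \<approx> r"
  using word_cong.rel[of l r "singular_rels V E" A "[]" "[]"] by (simp add: cong_def)

lemma Sig_SigInv: "u \<in> V \<Longrightarrow> [Sig u, SigInv u] \<approx> []" "u \<in> V \<Longrightarrow> [SigInv u, Sig u] \<approx> []"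
  by (rule cong_rel; auto simp: singular_rels_def gens)+

text \<open>The presentation imposes commutations on \<open>Sig\<close> and \<open>Tau\<close> only.
  Those of \<open>SigInv\<close> follow by inserting \<open>[Sig u, SigInv u]\<close> on the right
  and moving \<open>Sig u\<close> across \<open>b\<close>.\<close>

lemma commute_SigInv:
  assumes u: "u \<in> V" and b: "b \<in> A" and c: "[Sig u, b] \<approx> [b, Sig u]"
  shows "[SigInv u, b] \<approx> [b, SigInv u]"
proof -
  have l: "Sig u \<in> A" "SigInv u \<in> A" using u by (auto simp: gens)
  have "[SigInv u, b] @ [] @ [] \<approx> [SigInv u, b] @ [Sig u, SigInv u] @ []"
    using l b by (intro cong_context cong_sym[OF Sig_SigInv(1)] u) auto
  also have "[SigInv u, b] @ [Sig u, SigInv u] @ [] = [SigInv u] @ [b, Sig u] @ [SigInv u]" by simp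
  also have "\<dots> \<approx> [SigInv u] @ [Sig u, b] @ [SigInv u]"
    using l b by (intro cong_context cong_sym[OF c]) auto
  also have "\<dots> = [] @ [SigInv u, Sig u] @ [b, SigInv u]" by simp
  also have "\<dots> \<approx> [] @ [] @ [b, SigInv u]"
    using l b by (intro cong_context Sig_SigInv(2) u) auto
  finally show ?thesis by simp
qed

lemma commute_same:
  assumes u: "u \<in> V" and "a \<in> letters u" "b \<in> letters u"
  shows "[a, b] \<approx> [b, a]"
proof -
  have l: "Sig u \<in> A" "SigInv u \<in> A" "Tau u \<in> A" using u by (auto simp: gens)
  have 1: "[Sig u, SigInv u] \<approx> [SigInv u, Sig u]"
    using Sig_SigInv[OF u] by (blast intro: cong_trans cong_sym)
  have 2: "[Sig u, Tau u] \<approx> [Tau u, Sig u]"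
    using l u by (intro cong_rel) (auto simp: singular_rels_def)
  note 3 = commute_SigInv[OF u l(3) 2]
  have "[c, c] \<approx> [c, c]" if "c \<in> letters u" for c
    using that l by (intro cong_refl) auto
  then show ?thesis
    using assms(2,3) 1 2 3 cong_sym[OF 1] cong_sym[OF 2] cong_sym[OF 3] by auto
qed

lemma commute_edge:
  assumes e: "{u, v} \<in> E" and a: "a \<in> letters u" and b: "b \<in> letters v"
  shows "[a, b] \<approx> [b, a]"
proof -
  have l: "w \<in> V \<Longrightarrow> Sig w \<in> A" "w \<in> V \<Longrightarrow> SigInv w \<in> A" "w \<in> V \<Longrightarrow> Tau w \<in> A" for w
    by (auto simp: gens)
  note V = edge[THEN conjunct1] edge[THEN conjunct2, THEN conjunct1]
  have rels: "[Sig u, Sig v] \<approx> [Sig v, Sig u]" "[Sig u, Tau v] \<approx> [Tau v, Sig u]"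
    "[Tau u, Tau v] \<approx> [Tau v, Tau u]" if "{u, v} \<in> E" for u v
    by (rule cong_rel; use that V[OF that] l in \<open>auto simp: singular_rels_def\<close>)+
  have e': "{v, u} \<in> E" using e by (simp add: insert_commute)
  note c = rels[OF e] cong_sym[OF rels(2)[OF e']]
  have i: "[Sig u, SigInv v] \<approx> [SigInv v, Sig u]" "[Tau u, SigInv v] \<approx> [SigInv v, Tau u]"
    using V[OF e] l c by (blast intro: cong_sym commute_SigInv)+
  have "[SigInv u, b] \<approx> [b, SigInv u]"
    using b V[OF e] l c i by (intro commute_SigInv) auto
  then show ?thesis using a b c i by auto
qed

lemma commute_words:
  assumes "x \<in> lists A" "y \<in> lists A" "\<And>a b. a \<in> set x \<Longrightarrow> b \<in> set y \<Longrightarrow> [a, b] \<approx> [b, a]"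
  shows "x @ y \<approx> y @ x"
proof -
  have 1: "[a] @ y \<approx> y @ [a]" if "a \<in> A" "y \<in> lists A" "\<forall>b\<in>set y. [a, b] \<approx> [b, a]" for a y
    using that(2,3)
  proof (induction y)
    case Nil
    then show ?case using that(1) by (simp add: cong_refl)
  next
    case (Cons b y)
    have "[] @ [a, b] @ y \<approx> [] @ [b, a] @ y"
      using Cons by (intro cong_context) auto
    also have "[] @ [b, a] @ y = [b] @ ([a] @ y) @ []" by simp
    also have "\<dots> \<approx> [b] @ (y @ [a]) @ []"
      using Cons by (intro cong_context) auto
    finally show ?case by simp
  qed
  show ?thesis
    using assms(1,3)
  proof (induction x)
    case Nil
    then show ?case using assms(2) by (simp add: cong_refl)
  next
    case (Cons a x)
    have "[a] @ (x @ y) @ [] \<approx> [a] @ (y @ x) @ []"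
      using Cons by (intro cong_context) auto
    also have "[a] @ (y @ x) @ [] = [] @ ([a] @ y) @ x" by simp
    also have "\<dots> \<approx> [] @ (y @ [a]) @ x"
      using Cons assms(2) by (intro cong_context 1) auto
    finally show ?case by simp
  qed
qed

text \<open>A letter \<open>Tau u\<close> would make \<open>eval1 x\<close> zero, whereas
  \<open>eval2 x\<close> never vanishes. So \<open>x\<close> is a power of \<sigma>, and comparing
  its values 1 and 2 ^ m / 2 ^ n at the two eigenvalues forces exponent zero.\<close>

lemma trivial_syllable:
  assumes u: "u \<in> V" and x: "x \<in> lists (letters u)" and ev: "eval1 x = eval2 x"
  shows "x \<approx> []"
proof -
  let ?s = "\<lambda>m n. replicate m (Sig u) @ replicate n (SigInv u)"
  have l: "Sig u \<in> A" "SigInv u \<in> A" "Tau u \<in> A" using u by (auto simp: gens)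
  have ls: "?s m n \<in> lists A" "replicate m (Sig u) \<in> lists A" "replicate n (SigInv u) \<in> lists A" for m n
    using l by auto
  have "eval2 x \<noteq> 0"
    using x unfolding eval2_def by (induction x) auto
  moreover have "eval1 x = 0" if "Tau u \<in> set x"
    using that by (force simp: eval1_def prod_list_zero_iff)
  ultimately have "Tau u \<notin> set x" using ev by auto
  then have x': "x \<in> lists {Sig u, SigInv u}" using x by auto
  have "\<exists>m n. x \<approx> ?s m n \<and> eval1 x = 1 \<and> eval2 x = 2 ^ m / 2 ^ n"
    using x'
  proof (induction x)
    case Nil
    have "[] \<approx> ?s 0 0" by (simp add: cong_refl)
    then show ?case by (intro exI[of _ 0]) (simp add: eval1_def eval2_def)
  next
    case (Cons a x)
    then obtain m n where mn: "x \<approx> ?s m n" "eval1 x = 1" "eval2 x = 2 ^ m / 2 ^ n" by blast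
    have e1: "eval1 (a # x) = 1" using Cons.hyps mn(2) by (auto simp: eval1_def)
    have s: "[a] @ x @ [] \<approx> [a] @ ?s m n @ []"
      using Cons.hyps l mn by (intro cong_context) auto
    show ?case
    proof (cases "a = Sig u")
      case True
      then have "a # x \<approx> ?s (Suc m) n" using s by simp
      moreover have "eval2 (a # x) = 2 ^ Suc m / 2 ^ n" using mn True by (simp add: eval2_def)
      ultimately show ?thesis using e1 by blast
    next
      case False
      then have a: "a = SigInv u" using Cons.hyps by simp
      have "[] @ ([SigInv u] @ replicate m (Sig u)) @ replicate n (SigInv u) \<approx>
          [] @ (replicate m (Sig u) @ [SigInv u]) @ replicate n (SigInv u)"
        using l by (intro cong_context commute_words commute_same[OF u]) auto
      with s have "a # x \<approx> ?s m (Suc n)"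
        using a by (auto intro: cong_trans)
      moreover have "eval2 (a # x) = 2 ^ m / 2 ^ Suc n" using mn a by (simp add: eval2_def)
      ultimately show ?thesis using e1 by blast
    qed
  qed
  then obtain m n where mn: "x \<approx> ?s m n" "eval1 x = 1" "eval2 x = 2 ^ m / 2 ^ n" by blast
  have "(2::rat) ^ m = 2 ^ n" using mn ev by simp
  then have "m = n" by simp
  moreover have "?s k k \<approx> []" for k
  proof (induction k)
    case 0
    then show ?case by (simp add: cong_refl)
  next
    case (Suc k)
    have "replicate k (Sig u) @ [Sig u, SigInv u] @ replicate k (SigInv u) \<approx>
        replicate k (Sig u) @ [] @ replicate k (SigInv u)"
      using l by (intro cong_context Sig_SigInv u) auto
    also have "\<dots> \<approx> []" using Suc by simp
    finally show ?case by (simp add: replicate_app_Cons_same)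
  qed
  ultimately show ?thesis using mn(1) by (blast intro: cong_trans)
qed

lemma tau_front:
  assumes u: "u \<in> V" and x: "x \<in> lists (letters u)" "Tau u \<in> set x"
  obtains x' where "x' \<in> lists A" "x \<approx> Tau u # x'"
proof -
  obtain p q where x_eq: "x = p @ Tau u # q" using x(2) split_list by metis
  have pq: "p \<in> lists (letters u)" "q \<in> lists (letters u)" using x(1) x_eq by auto
  have l: "p \<in> lists A" "q \<in> lists A" "Tau u \<in> A" using pq letters_A[OF u] by auto
  have "[] @ (p @ [Tau u]) @ q \<approx> [] @ ([Tau u] @ p) @ q"
    using l pq by (intro cong_context commute_words commute_same[OF u]) auto
  then show thesis using that[of "p @ q"] l x_eq by simp
qed


section \<open>Left divisibility and injectivity\<close>


text \<open>The vertex is stored next to its block of letters because the block may be empty. Blocks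
  need not be maximal; reducedness comes later from minimal length.\<close>

definition syllables :: "('v \<times> 'v sgen list) list \<Rightarrow> bool" where
  "syllables L \<longleftrightarrow> (\<forall>(v, x)\<in>set L. v \<in> V \<and> x \<in> lists (letters v))"

abbreviation flat :: "('v \<times> 'v sgen list) list \<Rightarrow> 'v sgen list" where
  "flat L \<equiv> concat (map snd L)"

lemma syllables_append [simp]: "syllables (L @ L') \<longleftrightarrow> syllables L \<and> syllables L'"
  by (auto simp: syllables_def)

lemma syllables_Cons [simp]:
  "syllables ((v, x) # L) \<longleftrightarrow> v \<in> V \<and> x \<in> lists (letters v) \<and> syllables L"
  by (auto simp: syllables_def)

lemma flat_lists: "syllables L \<Longrightarrow> flat L \<in> lists A"
proof (induction L)
  case (Cons p L)
  then obtain v x where "p = (v, x)" "v \<in> V" "x \<in> lists (letters v)" "flat L \<in> lists A"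
    by (cases p) auto
  then show ?case using lists_mono[OF letters_A[of v]] by auto
qed simp

lemma ex_syllables:
  assumes "w \<in> lists A"
  shows "\<exists>L. syllables L \<and> flat L = w"
  using assms
proof (induction w)
  case Nil
  show ?case by (rule exI[of _ "[]"]) (simp add: syllables_def)
next
  case (Cons a w)
  then obtain u L where "u \<in> V" "a \<in> letters u" "syllables L" "flat L = w"
    unfolding gens by blast
  then show ?case by (intro exI[of _ "(u, [a]) # L"]) auto
qed

lemma commute_syllables:
  assumes L: "syllables L" "\<forall>(a, y)\<in>set L. {v, a} \<in> E" and x: "v \<in> V" "x \<in> lists (letters v)"
  shows "flat L @ x \<approx> x @ flat L"
proof (rule cong_sym, rule commute_words)
  show "x \<in> lists A" using x letters_A by blast
  show "flat L \<in> lists A" using L by (intro flat_lists)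
  show "[a, b] \<approx> [b, a]" if a: "a \<in> set x" and b: "b \<in> set (flat L)" for a b
  proof -
    from b obtain w y where "(w, y) \<in> set L" "b \<in> set y" by auto
    then have "{v, w} \<in> E" "b \<in> letters w" using L by (auto simp: syllables_def)
    moreover have "a \<in> letters v" using a x(2) by auto
    ultimately show ?thesis by (blast intro: commute_edge)
  qed
qed

text \<open>
  Among all pairs of a word \<open>g\<close> in \<open>\<sigma>\<^sub>u\<^sup>\<plusminus>\<^sup>1\<close> and a list \<open>L\<close> of syllables with \<open>w' \<approx> g \<cdot> L\<close>, take one with
  \<open>L\<close> shortest. If no \<open>u\<close>-syllable can be moved to the front of \<open>L\<close>, then \<open>\<sigma>\<^sub>u\<close> fixes the start vector
  of the heap representation of \<open>L\<close>, so \<open>\<tau>\<^sub>u\<close> kills it, while \<open>w'\<close> does not.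
\<close>

lemma tau_divides:
  assumes u: "u \<in> V" and w: "w \<in> lists A" "w' \<in> lists A"
    and eq: "\<eta> (cls (Tau u # w)) = \<eta> (cls w')"
  shows "\<exists>w''\<in>lists A. w' \<approx> Tau u # w''"
proof -
  let ?P = "\<lambda>k. \<exists>L g. length L = k \<and> syllables L \<and> g \<in> lists {Sig u, SigInv u} \<and> g @ flat L \<approx> w'"
  obtain L0 where "syllables L0" "flat L0 = w'" using ex_syllables[OF w(2)] by blast
  then have "?P (length L0)" using w(2) by (intro exI[of _ L0] exI[of _ "[]"]) (simp add: cong_refl)
  then have "?P (LEAST k. ?P k)" by (rule LeastI)
  then obtain L g where L: "syllables L" "g \<in> lists {Sig u, SigInv u}" "g @ flat L \<approx> w'"
    and len: "length L = (LEAST k. ?P k)" by blast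
  have min: "length L \<le> length L'"
    if "syllables L'" "g' \<in> lists {Sig u, SigInv u}" "w' \<approx> g' @ flat L'" for L' g'
    unfolding len using that cong_sym[OF that(3)] by (intro Least_le) blast
  have g: "g \<in> lists A" using L(2) u by (auto simp: gens)
  show ?thesis
  proof (cases "\<exists>L1 x L2. L = L1 @ (u, x) # L2 \<and> (\<forall>(a, y)\<in>set L1. {u, a} \<in> E)")
    case True
    then obtain L1 x L2 where L_eq: "L = L1 @ (u, x) # L2" and L1: "\<forall>(a, y)\<in>set L1. {u, a} \<in> E"
      by blast
    have x: "x \<in> lists (letters u)" and s: "syllables L1" "syllables L2"
      using L(1) L_eq by auto
    have l: "x \<in> lists A" "flat L1 \<in> lists A" "flat L2 \<in> lists A"
      using flat_lists s x letters_A[OF u] by blast+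
    have "w' \<approx> g @ (flat L1 @ x) @ flat L2" using cong_sym[OF L(3)] L_eq by simp
    also have "\<dots> \<approx> g @ (x @ flat L1) @ flat L2"
      using commute_syllables[OF s(1) L1 u x] g l(3) by (rule cong_context)
    finally have w'_eq: "w' \<approx> g @ x @ flat L1 @ flat L2" by simp
    show ?thesis
    proof (cases "Tau u \<in> set x")
      case True
      then obtain x' where x': "x' \<in> lists A" "x \<approx> Tau u # x'" using tau_front[OF u x] by blast
      let ?r = "x' @ flat L1 @ flat L2"
      have "Tau u \<in> A" using u by (simp add: gens)
      note w'_eq
      also have "g @ x @ flat L1 @ flat L2 \<approx> g @ (Tau u # x') @ flat L1 @ flat L2"
        using x' g l by (intro cong_context) auto
      also have "\<dots> = [] @ (g @ [Tau u]) @ ?r" by simp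
      also have "\<dots> \<approx> [] @ ([Tau u] @ g) @ ?r"
        using x' g l L(2) \<open>Tau u \<in> A\<close>
        by (intro cong_context commute_words commute_same[OF u]) auto
      finally have "w' \<approx> Tau u # (g @ ?r)" by simp
      moreover have "g @ ?r \<in> lists A" using g x' l by simp
      ultimately show ?thesis by blast
    next
      case False
      \<comment> \<open>Without \<open>Tau u\<close> the syllable could be absorbed into
        \<open>g\<close>, leaving a shorter list.\<close>
      then have "x \<in> lists {Sig u, SigInv u}" using x by auto
      then have "length L \<le> length (L1 @ L2)"
        using L(2) s w'_eq by (intro min[of _ "g @ x"]) auto
      then show ?thesis using L_eq by simp
    qed
  next
    case no_head: False
    \<comment> \<open>Two syllables at the same vertex with only commuting syllables between them
      could be merged, contradicting the minimality of \<open>L\<close>. This is the axiom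
      \<open>reduced\<close> of the heap.\<close>
    have reduced: "\<exists>k>i. k < j \<and> {fst (L ! i), fst (L ! k)} \<notin> E"
      if ij: "i < j" "j < length L" and eq: "fst (L ! i) = fst (L ! j)" for i j
    proof (rule ccontr)
      assume no: "\<not> ?thesis"
      obtain v x y where vx: "L ! i = (v, x)" and vy: "L ! j = (v, y)"
        using eq by (metis prod.collapse)
      let ?L1 = "take i L" and ?L2 = "take (j - Suc i) (drop (Suc i) L)" and ?L3 = "drop (Suc j) L"
      have L_eq: "L = ?L1 @ (v, x) # ?L2 @ (v, y) # ?L3"
        using list_split_two_nth[OF ij] vx vy by simp
      then have "syllables (?L1 @ (v, x) # ?L2 @ (v, y) # ?L3)" using L(1) by simp
      then have s: "syllables ?L1" "syllables ?L2" "syllables ?L3"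
        and v: "v \<in> V" "x \<in> lists (letters v)" "y \<in> lists (letters v)" by auto
      have adj: "\<forall>(a, z)\<in>set ?L2. {v, a} \<in> E"
      proof (clarify)
        fix a z assume "(a, z) \<in> set ?L2"
        then obtain k where k: "k < length ?L2" "?L2 ! k = (a, z)" by (metis in_set_conv_nth)
        then have "L ! (Suc i + k) = (a, z)" "Suc i + k < j" using ij by auto
        then show "{v, a} \<in> E" using no vx by (force dest: spec[of _ "Suc i + k"])
      qed
      have l: "x \<in> lists A" "y \<in> lists A" "flat ?L1 \<in> lists A" "flat ?L2 \<in> lists A" "flat ?L3 \<in> lists A"
        using flat_lists s v letters_A[OF v(1)] by blast+
      have "w' \<approx> g @ flat L" using L(3) by (rule cong_sym)
      also have "g @ flat L = (g @ flat ?L1 @ x) @ (flat ?L2 @ y) @ flat ?L3"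
        by (subst L_eq) simp
      also have "\<dots> \<approx> (g @ flat ?L1 @ x) @ (y @ flat ?L2) @ flat ?L3"
        using g l commute_syllables[OF s(2) adj v(1,3)] by (intro cong_context) auto
      also have "\<dots> = g @ flat (?L1 @ (v, x @ y) # ?L2 @ ?L3)" by simp
      finally have "length L \<le> length (?L1 @ (v, x @ y) # ?L2 @ ?L3)"
        using L(2) s v by (intro min[of _ g]) auto
      then show False using ij by simp
    qed
    \<comment> \<open>A syllable with equal values is congruent to the empty word by
      \<open>trivial_syllable\<close> and could be dropped from \<open>L\<close>.\<close>
    have nontrivial: "x \<in> lists (letters v) \<and> eval1 x \<noteq> eval2 x" if "(v, x) \<in> set L" for v x
    proof -
      obtain L1 L2 where L_eq: "L = L1 @ (v, x) # L2" using \<open>(v, x) \<in> set L\<close> split_list by metis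
      have v: "v \<in> V" "x \<in> lists (letters v)" and s: "syllables L1" "syllables L2"
        using L(1) L_eq by auto
      have "eval1 x \<noteq> eval2 x"
      proof
        assume "eval1 x = eval2 x"
        then have "x \<approx> []" by (rule trivial_syllable[OF v])
        have "w' \<approx> (g @ flat L1) @ x @ flat L2" using cong_sym[OF L(3)] L_eq by simp
        also have "\<dots> \<approx> (g @ flat L1) @ [] @ flat L2"
          using \<open>x \<approx> []\<close> g flat_lists s by (intro cong_context) auto
        finally have "length L \<le> length (L1 @ L2)"
          using L(2) s by (intro min[of _ g]) auto
        then show False using L_eq by simp
      qed
      with v show ?thesis by blast
    qed
    interpret H: heap "\<lambda>a b. {a, b} \<in> E" "\<lambda>i. fst (L ! i)" "length L"
    proof
      show "{u, v} \<in> E \<Longrightarrow> {v, u} \<in> E" for u v by (simp add: insert_commute)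
      show "{v, v} \<notin> E" for v using edge by blast
      show "\<exists>k>i. k < j \<and> {fst (L ! i), fst (L ! k)} \<notin> E"
        if "i < j" "j < length L" "fst (L ! i) = fst (L ! j)" for i j
        using that by (rule reduced)
    qed
    \<comment> \<open>Otherwise the syllable \<open>i\<close> could be moved to the front, which
      \<open>no_head\<close> rules out. This is the hypothesis of \<open>T_point\<close>.\<close>
    have "\<exists>j<i. {u, fst (L ! j)} \<notin> E" if i: "i < length L" "fst (L ! i) = u" for i
    proof (rule ccontr)
      assume no: "\<not> ?thesis"
      have "L = take i L @ (u, snd (L ! i)) # drop (Suc i) L"
        using id_take_nth_drop[OF i(1)] i(2) by (metis prod.collapse)
      moreover have "\<forall>(a, y)\<in>set (take i L). {u, a} \<in> E"
        using no i(1) by (force simp: in_set_conv_nth)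
      ultimately show False using no_head by blast
    qed
    then have pt: "H.T u H.point = H.point" "H.T' u H.point = H.point"
      by (intro H.T_point; blast)+
    let ?op = "word_op H.T H.T'"
    have "?op g H.point = H.point"
      using L(2) by (induction g) (auto simp: pt)
    then have "?op (g @ flat L) H.point {..<length L} = ?op (flat L) H.point {..<length L}"
      by simp
    also have "\<dots> \<noteq> 0"
      by (rule H.word_op_point) (use nontrivial in auto)
    finally have ne: "?op (g @ flat L) H.point {..<length L} \<noteq> 0" .
    have zero: "H.T v (\<lambda>D. 0) = (\<lambda>D. 0)" "H.T' v (\<lambda>D. 0) = (\<lambda>D. 0)" for v
      by (auto simp: H.T_def H.T'_def)
    have "Tau u # w \<in> lists A" using u w by (auto simp: gens)
    moreover have "g @ flat L \<in> lists A" using g flat_lists[OF L(1)] by simp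
    moreover have "\<eta> (cls (Tau u # w)) = \<eta> (cls (g @ flat L))"
      using eq cls_eqI[OF L(3)] by simp
    ultimately have "?op (Tau u # w) H.point = ?op (g @ flat L) H.point"
      by (intro word_op_desingularization H.T_linear H.T_T' H.T_commute)
    \<comment> \<open>\<open>Tau u\<close> acts first, as the difference of two operators that both
      fix \<open>H.point\<close>.\<close>
    moreover have "?op (Tau u # w) H.point = ?op w (\<lambda>D. 0)"
      by (simp add: pt)
    moreover have "?op w (\<lambda>D. 0) = (\<lambda>D. 0)"
    proof (induction w)
      case (Cons a w)
      then show ?case by (cases a) (simp_all add: zero)
    qed simp
    ultimately show ?thesis using ne by simp
  qed
qed

section \<open>Words without singular letters\<close>

definition signed :: "'v \<times> bool \<Rightarrow> 'v sgen" where
  "signed p = (if snd p then Sig (fst p) else SigInv (fst p))"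

lemma \<eta>_signed:
  assumes "p \<in> lists (V \<times> UNIV)"
  shows "\<eta> (cls (map signed p)) = frag_of (gcls p)"
  using assms
proof (induction p)
  case Nil
  then show ?case by (simp add: \<eta>_spec G_def one_presented_monoid)
next
  case (Cons a p)
  obtain u b where a: "a = (u, b)" by force
  then have u: "u \<in> V" using Cons by simp
  have p: "map signed p \<in> lists A"
    using Cons.hyps(2) by (force simp: gens signed_def)
  have "gcls [(u, True)] \<otimes>\<^bsub>G\<^esub> gcls [(u, False)] = gcls [(u, True), (u, False)]"
    using u by (simp add: G_def mult_presented_monoid)
  also have "\<dots> = gcls []"
  proof -
    have "([(u, True), (u, False)], []) \<in> graph_group_rels E \<union> inverse_rels V"
      using u by (auto simp: inverse_rels_def)
    from word_cong.rel[OF this, of "V \<times> UNIV" "[]" "[]"] show ?thesis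
      using u by (simp add: word_class_eq_iff)
  qed
  \<comment> \<open>The formal inverse letter represents the group inverse, which is what the
    specification of \<eta> on \<open>SigInv u\<close> refers to.\<close>
  finally have "\<sigma> u \<otimes>\<^bsub>G\<^esub> gcls [(u, False)] = \<one>\<^bsub>G\<^esub>"
    by (simp add: \<sigma>_def G_def one_presented_monoid)
  moreover have "gcls [(u, False)] \<in> carrier G"
    using u by (auto simp: G_def carrier_presented_monoid)
  ultimately have "inv\<^bsub>G\<^esub> \<sigma> u = gcls [(u, False)]"
    using \<sigma>_closed[OF u] G.inv_equality G.inv_comm by blast
  then have "\<eta> (cls [signed a]) = frag_of (gcls [a])"
    using u a by (cases b) (simp_all add: signed_def \<eta>_spec \<sigma>_def)
  moreover have "\<eta> (cls (map signed (a # p))) = \<eta> (cls [signed a]) \<otimes>\<^bsub>R\<^esub> \<eta> (cls (map signed p))"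
    using u a \<eta>_Cons[OF _ p, of "signed a"] by (auto simp: gens signed_def)
  ultimately have "\<eta> (cls (map signed (a # p))) = frag_of (gcls [a] \<otimes>\<^bsub>G\<^esub> gcls p)"
    by (simp add: Cons.IH int_group_ring_mult_frag_of)
  also have "gcls [a] \<otimes>\<^bsub>G\<^esub> gcls p = gcls (a # p)"
    using Cons.hyps by (simp add: G_def mult_presented_monoid)
  finally show ?case .
qed

text \<open>The relations of the graph group hold in the singular monoid, so group words equal in
  the graph group stay equal there. With \<open>\<eta>_signed\<close> this gives injectivity of
  \<eta> on words without \<open>Tau\<close>.\<close>

lemma signed_cong:
  assumes "(p, q) \<in> word_cong (V \<times> UNIV) (graph_group_rels E \<union> inverse_rels V)"
  shows "map signed p \<approx> map signed q"
  using assms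
proof (induction rule: word_cong.induct)
  case (rel l r p q)
  have lists: "map signed w \<in> lists A" if "w \<in> lists (V \<times> UNIV)" for w
    using that by (force simp: gens signed_def)
  have "map signed l \<approx> map signed r"
    using rel(1)
  proof
    assume "(l, r) \<in> graph_group_rels E"
    then obtain u v where "l = [(u, True), (v, True)]" "r = [(v, True), (u, True)]" "{u, v} \<in> E"
      by (auto simp: graph_group_rels_def)
    then show ?thesis using commute_edge[of u v "Sig u" "Sig v"] by (simp add: signed_def)
  next
    assume "(l, r) \<in> inverse_rels V"
    then obtain u b where "l = [(u, b), (u, \<not> b)]" "r = []" "u \<in> V"
      by (auto simp: inverse_rels_def)
    then show ?thesis using Sig_SigInv[of u] by (simp add: signed_def)
  qed
  then show ?case using cong_context lists rel by simp
next
  case (refl w)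
  then show ?case by (intro cong_refl) (force simp: gens signed_def)
qed (blast intro: cong_sym cong_trans)+

text \<open>The augmentation shows that \<open>w\<close> has no \<open>Tau\<close> letter. Then
  \<open>w\<close> comes from a group word that is trivial in the graph group, and
  \<open>signed_cong\<close> applies.\<close>

lemma \<eta>_eq_one:
  assumes w: "w \<in> lists A" and eq: "\<eta> (cls w) = \<eta> (cls [])"
  shows "w \<approx> []"
proof -
  \<comment> \<open>In the trivial representation on functions over \<open>unit\<close> every group
    letter acts as the identity and every \<open>Tau\<close> as zero; this is the
    augmentation.\<close>
  have "word_op (\<lambda>u F. F) (\<lambda>u F. F) w (\<lambda>_ :: unit. 1) =
      word_op (\<lambda>u F. F) (\<lambda>u F. F) ([] :: 'v sgen list) (\<lambda>_. 1)"
    by (rule word_op_desingularization) (use assms in simp_all)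
  \<comment> \<open>The constant is general because the induction continues with 0 after a
    \<open>Tau\<close> letter.\<close>
  moreover have "word_op (\<lambda>u F. F) (\<lambda>u F. F) w (\<lambda>_ :: unit. c) =
      (\<lambda>_. if \<exists>u. Tau u \<in> set w then 0 else c)" for c
  proof (induction w arbitrary: c)
    case (Cons a w)
    then show ?case by (cases a) auto
  qed simp
  ultimately have no: "Tau u \<notin> set w" for u
    by (auto simp: fun_eq_iff split: if_splits)
  have "\<exists>p\<in>lists (V \<times> UNIV). w = map signed p"
    using w no
  proof (induction w)
    case Nil
    then show ?case by simp
  next
    case (Cons a w)
    then obtain p where p: "p \<in> lists (V \<times> UNIV)" "w = map signed p" by auto
    from Cons obtain u where "u \<in> V" "a = Sig u \<or> a = SigInv u" by (auto simp: gens)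
    then have "a = signed (u, a = Sig u)" by (auto simp: signed_def)
    with p \<open>u \<in> V\<close> show ?case by (intro bexI[of _ "(u, a = Sig u) # p"]) auto
  qed
  then obtain p where p: "p \<in> lists (V \<times> UNIV)" "w = map signed p" by blast
  have "frag_of (gcls p) = frag_of (gcls [])"
    using eq \<eta>_signed[OF p(1)] \<eta>_signed[of "[]"] p(2) by simp
  then have "gcls p = gcls []" by (simp only: frag_of_eq)
  then have "(p, []) \<in> word_cong (V \<times> UNIV) (graph_group_rels E \<union> inverse_rels V)"
    using word_class_eq_iff[OF p(1) lists.Nil] by simp
  then show ?thesis using signed_cong[of p "[]"] p(2) by simp
qed

lemma \<eta>_inject:
  assumes "w \<in> lists A" "w' \<in> lists A" "\<eta> (cls w) = \<eta> (cls w')"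
  shows "w \<approx> w'"
  using assms
proof (induction arbitrary: w')
  case Nil
  then show ?case using \<eta>_eq_one cong_sym by metis
next
  case (Cons a w)
  then obtain u where u: "u \<in> V" and a: "a = Sig u \<or> a = SigInv u \<or> a = Tau u"
    unfolding gens by blast
  \<comment> \<open>With \<open>b\<close> the inverse letter of \<open>a\<close>, the induction
    hypothesis is applied to \<open>w\<close> and \<open>b # w'\<close>; this needs
    \<open>w'\<close> to be arbitrary.\<close>
  have invertible: "a # w \<approx> w'" if b: "b \<in> A" "[b, a] \<approx> []" "[a, b] \<approx> []" for b
  proof -
    have l: "a \<in> A" "w \<in> lists A" "w' \<in> lists A" using Cons by auto
    have "[] @ [b, a] @ w \<approx> [] @ [] @ w"
      using b l by (intro cong_context) auto
    then have "\<eta> (cls w) = \<eta> (cls (b # a # w))" using cls_eqI[of "b # a # w" w] by simp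
    also have "\<dots> = \<eta> (cls (b # w'))"
      using l Cons.prems \<eta>_Cons[OF b(1), of "a # w"] \<eta>_Cons[OF b(1), of w'] by simp
    finally have "w \<approx> b # w'" using b l by (intro Cons.IH) auto
    then have "[a] @ w @ [] \<approx> [a] @ (b # w') @ []" using l by (intro cong_context) auto
    also have "[a] @ (b # w') @ [] = [] @ [a, b] @ w'" by simp
    also have "\<dots> \<approx> [] @ [] @ w'" using b l by (intro cong_context) auto
    finally show ?thesis by simp
  qed
  show ?case
  proof (cases "a = Tau u")
    case False
    then show ?thesis
      using a u Sig_SigInv[OF u] invertible[of "SigInv u"] invertible[of "Sig u"] by (auto simp: gens)
  next
    case True
    have t: "Tau u \<in> A" using u by (simp add: gens)
    \<comment> \<open>\<open>w'\<close> is replaced by a congruent word that also starts with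
      \<open>Tau u\<close>, so that \<open>tau_cancel\<close> can remove the letter from both
      sides.\<close>
    obtain w'' where w'': "w'' \<in> lists A" "w' \<approx> Tau u # w''"
      using tau_divides[OF u Cons.hyps(2) Cons.prems(1)] Cons.prems(2) True by auto
    have "\<eta> (cls (Tau u # w)) = \<eta> (cls (Tau u # w''))"
      using Cons.prems(2) cls_eqI[OF w''(2)] True by simp
    then have "(frag_of (\<sigma> u) - frag_of (inv\<^bsub>G\<^esub> \<sigma> u)) \<otimes>\<^bsub>R\<^esub> \<eta> (cls w) =
        (frag_of (\<sigma> u) - frag_of (inv\<^bsub>G\<^esub> \<sigma> u)) \<otimes>\<^bsub>R\<^esub> \<eta> (cls w'')"
      unfolding \<eta>_Cons[OF t Cons.hyps(2)] \<eta>_Cons[OF t w''(1)] \<eta>_spec(5)[OF u] .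
    then have "\<eta> (cls w) = \<eta> (cls w'')"
      by (rule tau_cancel[OF u \<eta>_closed[OF Cons.hyps(2)] \<eta>_closed[OF w''(1)]])
    then have "w \<approx> w''" by (rule Cons.IH[OF w''(1)])
    then have "[Tau u] @ w @ [] \<approx> [Tau u] @ w'' @ []" using t by (intro cong_context) auto
    then have "a # w \<approx> Tau u # w''" using True by simp
    also have "\<dots> \<approx> w'" by (rule cong_sym[OF w''(2)])
    finally show ?thesis .
  qed
qed

end

theorem theorem5p1:
  fixes V :: "'v set" and E :: "'v set set"
  assumes "simple_graph V E"
  shows "inj_on (desingularization V E) (carrier (singular_monoid V E))"
proof -
  interpret graph_monoid V E by unfold_locales (rule assms)
  show ?thesis
  proof (rule inj_onI)
    fix X Y
    assume "X \<in> carrier (singular_monoid V E)" "Y \<in> carrier (singular_monoid V E)"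
      and eq: "\<eta> X = \<eta> Y"
    then obtain w w' where w: "w \<in> lists A" "X = cls w" "w' \<in> lists A" "Y = cls w'"
      unfolding singular_monoid_def carrier_presented_monoid by blast
    then have "w \<approx> w'" using eq by (intro \<eta>_inject) auto
    then show "X = Y" using w cls_eqI by simp
  qed
qed

end
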